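(* For any tree-shaped CQ ${\boldsymbol q}$ and any ontology $\mathcal{T}$, there is a PE-rewriting of ${\boldsymbol q}$ and $\mathcal{T}$ (over complete data) of size $|\mathcal{T}|\cdot|{\boldsymbol q}|^{1+\log d^{\boldsymbol q}_\mathcal{T}}$.
   Context: An ontology $\mathcal{T}$ is a finite set of tgds $\forall \vec{x}\,(\varphi(\vec{x}) \to \exists \vec{y} \bigwedge_i \psi_i(\vec{x},\vec{y}))$ with $\varphi,\psi_i$ unary or binary atoms without constants and $|\vec{x}\cup\vec{y}|\le 2$; $|\mathcal{T}|$ is the number of predicate occurrences. A data instance $\mathcal{A}$ is a finite set of ground atoms with constants $\mathsf{ind}(\mathcal{A})$; it is complete if every ground atom over $\mathsf{ind}(\mathcal{A})$ entailed by $\mathcal{T},\mathcal{A}$ is in $\mathcal{A}$. A CQ ${\boldsymbol q}(\vec{x})=\exists\vec{y}\,\varphi(\vec{x},\vec{y})$ has $\varphi$ a conjunction of unary/binary atoms over variables; $|{\boldsymbol q}|$ is its number of atoms. ${\boldsymbol q}$ is tree-shaped if its Gaifman graph (vertices: variables; edges: pairs of distinct variables co-occurring in an atom) is a tree. A PE-rewriting (over complete data) is a positive existential formula ${\boldsymbol q}'(\vec{x})$ without constants such that for all complete $\mathcal{A}$ and $\vec{a}\subseteq\mathsf{ind}(\mathcal{A})$: $\mathcal{T},\mathcal{A}\models{\boldsymbol q}(\vec{a})$ iff $\mathcal{A}\models{\boldsymbol q}'(\vec{a})$. Tree witnesses: for $\varrho(x)$ of the form $S(x)$, $S(x,x)$,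 $\exists y\,S(x,y)$ or $\exists y\,S(y,x)$ ($S$ a predicate of $\mathcal{T}$), let $\mathcal{C}_\mathcal{T}^{\varrho(a)}$ be the canonical model of $(\mathcal{T}\cup\{A(x)\to\varrho(x)\},\{A(a)\})$ with $A$ fresh. For a pair $\mathfrak{t}=(\mathfrak{t}_\mathsf{r},\mathfrak{t}_\mathsf{i})$ of disjoint sets of variables of ${\boldsymbol q}$ with $\emptyset\ne\mathfrak{t}_\mathsf{i}\subseteq\vec{y}$, let ${\boldsymbol q}_\mathfrak{t}$ be the set of atoms $S(\vec{z})$ of ${\boldsymbol q}$ with $\vec{z}\subseteq\mathfrak{t}_\mathsf{r}\cup\mathfrak{t}_\mathsf{i}$ and $\vec{z}\not\subseteq\mathfrak{t}_\mathsf{r}$. $\mathfrak{t}$ is a tree witness for ${\boldsymbol q}$ and $\mathcal{T}$ generated by $\varrho$ if ${\boldsymbol q}_\mathfrak{t}$ is a minimal subset of ${\boldsymbol q}$ for which there is a homomorphism $h\colon{\boldsymbol q}_\mathfrak{t}\to\mathcal{C}_\mathcal{T}^{\varrho(a)}$ with $\mathfrak{t}_\mathsf{r}=h^{-1}(a)$ and ${\boldsymbol q}_\mathfrak{t}$ contains all atoms of ${\boldsymbol q}$ with a variable from $\mathfrak{t}_\mathsf{i}$. $\Theta^{\boldsymbol q}_\mathcal{T}$ is the set of tree witnesses. The tree-witness degree is $d^{\boldsymbol q}_\mathcal{T}=1+\max_{z\in\vec{y}}|\{(\mathfrak{t}_\mathsf{r},\mathfrak{t}_\mathsf{i})\in\Theta^{\boldsymbol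 q}_\mathcal{T}\mid z\in\mathfrak{t}_\mathsf{i}\}|$. $\log$ is base 2.
   Formalization: The size bound is proved with max(1,|T|) in place of |T|; this differs only for the empty ontology, where the stated bound is 0 although every PE-formula contains at least one atom. *)

theory Defs
  imports Complex_Main
begin

section \<open>Atoms\<close>

text \<open>
  Predicate names, variables and constants are natural numbers. A predicate is a name together
  with its arity, so \<open>Unary 0\<close> and \<open>Binary 0\<close> are different predicates. The type of
  terms is a parameter: it is instantiated by variables, constants and elements of structures.
\<close>

type_synonym pname = nat
type_synonym var = nat
type_synonym const = nat

datatype (terms: 't) atom = Unary pname 't | Binary pname 't 't

fun un_names :: "'t atom \<Rightarrow> pname set" where
  "un_names (Unary S _) = {S}"
| "un_names (Binary _ _ _) = {}"

fun bin_names :: "'t atom \<Rightarrow> pname set" where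
  "bin_names (Unary _ _) = {}"
| "bin_names (Binary S _ _) = {S}"


section \<open>Ontologies and data instances\<close>

text \<open>
  In a tgd the universally quantified variables are those of the body, and the remaining
  variables of the head are existentially quantified.
\<close>

datatype tgd = TGD (body: "var atom") (head: "var atom list")

definition tgd_vars :: "tgd \<Rightarrow> var set" where
  "tgd_vars \<tau> = terms (body \<tau>) \<union> (\<Union>\<psi>\<in>set (head \<tau>). terms \<psi>)"

definition wf_tgd :: "tgd \<Rightarrow> bool" where
  "wf_tgd \<tau> \<longleftrightarrow> head \<tau> \<noteq> [] \<and> card (tgd_vars \<tau>) \<le> 2"

definition ontology :: "tgd set \<Rightarrow> bool" where
  "ontology T \<longleftrightarrow> finite T \<and> (\<forall>\<tau>\<in>T. wf_tgd \<tau>)"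

definition ontology_size :: "tgd set \<Rightarrow> nat" where
  "ontology_size T = (\<Sum>\<tau>\<in>T. 1 + length (head \<tau>))"

definition ontology_atoms :: "tgd set \<Rightarrow> var atom set" where
  "ontology_atoms T = (\<Union>\<tau>\<in>T. insert (body \<tau>) (set (head \<tau>)))"

definition ind :: "const atom set \<Rightarrow> const set" where
  "ind A = (\<Union>\<alpha>\<in>A. terms \<alpha>)"


section \<open>Conjunctive queries\<close>

text \<open>A CQ is given by the tuple of its answer variables and its set of atoms.\<close>

record cq =
  ans :: "var list"
  atoms :: "var atom set"

definition cq_vars :: "cq \<Rightarrow> var set" where
  "cq_vars q = (\<Union>\<alpha>\<in>atoms q. terms \<alpha>)"

definition ex_vars :: "cq \<Rightarrow> var set" where
  "ex_vars q = cq_vars q - set (ans q)"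

definition is_cq :: "cq \<Rightarrow> bool" where
  "is_cq q \<longleftrightarrow> finite (atoms q) \<and> atoms q \<noteq> {} \<and> distinct (ans q) \<and> set (ans q) \<subseteq> cq_vars q"

definition cq_size :: "cq \<Rightarrow> nat" where
  "cq_size q = card (atoms q)"

definition gaifman :: "cq \<Rightarrow> (var \<times> var) set" where
  "gaifman q = {(u, v). u \<noteq> v \<and> (\<exists>\<alpha>\<in>atoms q. u \<in> terms \<alpha> \<and> v \<in> terms \<alpha>)}"

definition is_tree :: "'v set \<Rightarrow> ('v \<times> 'v) set \<Rightarrow> bool" where
  "is_tree V E \<longleftrightarrow> V \<noteq> {} \<and> (\<forall>u\<in>V. \<forall>v\<in>V. (u, v) \<in> E\<^sup>*) \<and>
     \<not> (\<exists>c. set c \<subseteq> V \<and> length c \<ge> 3 \<and> distinct c \<and>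
          successively (\<lambda>u v. (u, v) \<in> E) c \<and> (last c, hd c) \<in> E)"

definition tree_shaped :: "cq \<Rightarrow> bool" where
  "tree_shaped q \<longleftrightarrow> is_tree (cq_vars q) (gaifman q)"


section \<open>Certain answers and complete data instances\<close>

text \<open>
  A first-order structure is given by its domain \<open>D\<close>, the set \<open>F\<close> of atoms that hold
  in it and the interpretation \<open>c\<close> of the constants. HOL cannot quantify over domains of
  all types. By the downward Loewenheim-Skolem theorem, domains that are nonempty
  (finite or infinite) sets of natural numbers yield the usual entailment relation, since the
  vocabulary is countable.
\<close>

definition sat_tgd :: "'d set \<Rightarrow> 'd atom set \<Rightarrow> tgd \<Rightarrow> bool" where
  "sat_tgd D F \<tau> \<longleftrightarrow>
     (\<forall>\<sigma>. \<sigma> ` terms (body \<tau>) \<subseteq> D \<and> map_atom \<sigma> (body \<tau>) \<in> F \<longrightarrow>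
       (\<exists>\<sigma>'. (\<forall>v\<in>terms (body \<tau>). \<sigma>' v = \<sigma> v) \<and> \<sigma>' ` tgd_vars \<tau> \<subseteq> D \<and>
             (\<forall>\<psi>\<in>set (head \<tau>). map_atom \<sigma>' \<psi> \<in> F)))"

definition is_model ::
  "'d set \<Rightarrow> 'd atom set \<Rightarrow> (const \<Rightarrow> 'd) \<Rightarrow> tgd set \<Rightarrow> const atom set \<Rightarrow> bool" where
  "is_model D F c T A \<longleftrightarrow>
     D \<noteq> {} \<and> (\<forall>\<alpha>\<in>F. terms \<alpha> \<subseteq> D) \<and> range c \<subseteq> D \<and>
     (\<forall>\<tau>\<in>T. sat_tgd D F \<tau>) \<and> (\<forall>\<alpha>\<in>A. map_atom c \<alpha> \<in> F)"

definition entails_atom :: "tgd set \<Rightarrow> const atom set \<Rightarrow> const atom \<Rightarrow> bool" where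
  "entails_atom T A \<alpha> \<longleftrightarrow>
     (\<forall>(D :: nat set) F c. is_model D F c T A \<longrightarrow> map_atom c \<alpha> \<in> F)"

definition entails_cq :: "tgd set \<Rightarrow> const atom set \<Rightarrow> cq \<Rightarrow> const list \<Rightarrow> bool" where
  "entails_cq T A q as \<longleftrightarrow>
     (\<forall>(D :: nat set) F c. is_model D F c T A \<longrightarrow>
       (\<exists>\<sigma>. \<sigma> ` cq_vars q \<subseteq> D \<and> map \<sigma> (ans q) = map c as \<and>
            (\<forall>\<alpha>\<in>atoms q. map_atom \<sigma> \<alpha> \<in> F)))"

definition complete_data :: "tgd set \<Rightarrow> const atom set \<Rightarrow> bool" where
  "complete_data T A \<longleftrightarrow> (\<forall>\<alpha>. terms \<alpha> \<subseteq> ind A \<and> entails_atom T A \<alpha> \<longrightarrow> \<alpha> \<in> A)"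


section \<open>Positive existential formulas and rewritings\<close>

datatype pe =
    Atom "var atom"
  | Eq var var
  | And pe pe
  | Or pe pe
  | Ex var pe

fun pe_fv :: "pe \<Rightarrow> var set" where
  "pe_fv (Atom \<alpha>) = terms \<alpha>"
| "pe_fv (Eq u v) = {u, v}"
| "pe_fv (And p r) = pe_fv p \<union> pe_fv r"
| "pe_fv (Or p r) = pe_fv p \<union> pe_fv r"
| "pe_fv (Ex v p) = pe_fv p - {v}"

text \<open>The size is the number of occurrences of atoms, equalities included.\<close>

fun pe_size :: "pe \<Rightarrow> nat" where
  "pe_size (Atom \<alpha>) = 1"
| "pe_size (Eq u v) = 1"
| "pe_size (And p r) = pe_size p + pe_size r"
| "pe_size (Or p r) = pe_size p + pe_size r"
| "pe_size (Ex v p) = pe_size p"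

fun pe_sat :: "'d set \<Rightarrow> 'd atom set \<Rightarrow> (var \<Rightarrow> 'd) \<Rightarrow> pe \<Rightarrow> bool" where
  "pe_sat D F \<sigma> (Atom \<alpha>) \<longleftrightarrow> map_atom \<sigma> \<alpha> \<in> F"
| "pe_sat D F \<sigma> (Eq u v) \<longleftrightarrow> \<sigma> u = \<sigma> v"
| "pe_sat D F \<sigma> (And p r) \<longleftrightarrow> pe_sat D F \<sigma> p \<and> pe_sat D F \<sigma> r"
| "pe_sat D F \<sigma> (Or p r) \<longleftrightarrow> pe_sat D F \<sigma> p \<or> pe_sat D F \<sigma> r"
| "pe_sat D F \<sigma> (Ex v p) \<longleftrightarrow> (\<exists>d\<in>D. pe_sat D F (\<sigma>(v := d)) p)"

text \<open>A data instance is evaluated as the structure with domain \<open>ind A\<close>.\<close>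

definition data_sat :: "const atom set \<Rightarrow> pe \<Rightarrow> var list \<Rightarrow> const list \<Rightarrow> bool" where
  "data_sat A p xs as \<longleftrightarrow> (\<exists>\<sigma>. map \<sigma> xs = as \<and> pe_sat (ind A) A \<sigma> p)"

definition pe_rewriting :: "tgd set \<Rightarrow> cq \<Rightarrow> pe \<Rightarrow> bool" where
  "pe_rewriting T q p \<longleftrightarrow>
     pe_fv p \<subseteq> set (ans q) \<and>
     (\<forall>A as. finite A \<and> complete_data T A \<and> length as = length (ans q) \<and> set as \<subseteq> ind A \<longrightarrow>
        (entails_cq T A q as \<longleftrightarrow> data_sat A p (ans q) as))"


section \<open>Canonical models\<close>

text \<open>
  The canonical model is the result of the oblivious chase: each tgd fires once for every image
  \<open>\<beta>\<close> of its body, and \<open>Null \<tau> \<beta> v\<close> is the witness that this firing creates for the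
  existential variable \<open>v\<close>.
\<close>

datatype elem = Cst const | Null tgd "elem atom" var

inductive_set canonical :: "tgd set \<Rightarrow> const atom set \<Rightarrow> elem atom set"
  for T :: "tgd set" and A :: "const atom set" where
  data: "\<alpha> \<in> A \<Longrightarrow> map_atom Cst \<alpha> \<in> canonical T A"
| fire: "\<lbrakk> \<tau> \<in> T; \<beta> = map_atom \<sigma> (body \<tau>); \<beta> \<in> canonical T A; \<psi> \<in> set (head \<tau>) \<rbrakk> \<Longrightarrow>
    map_atom (\<lambda>v. if v \<in> terms (body \<tau>) then \<sigma> v else Null \<tau> \<beta> v) \<psi> \<in> canonical T A"


section \<open>Tree witnesses\<close>

text \<open>The generators \<open>S(x)\<close>, \<open>S(x,x)\<close>, \<open>\<exists>y S(x,y)\<close> and \<open>\<exists>y S(y,x)\<close>.\<close>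

datatype gen = GUn pname | GLoop pname | GOut pname | GIn pname

definition gens :: "tgd set \<Rightarrow> gen set" where
  "gens T =
     GUn ` (\<Union>\<alpha>\<in>ontology_atoms T. un_names \<alpha>) \<union>
     (\<Union>S\<in>(\<Union>\<alpha>\<in>ontology_atoms T. bin_names \<alpha>). {GLoop S, GOut S, GIn S})"

text \<open>The head of \<open>A(x) \<rightarrow> \<rho>(x)\<close>, with \<open>x\<close> and \<open>y\<close> represented by 0 and 1.\<close>

fun gen_atom :: "gen \<Rightarrow> var atom" where
  "gen_atom (GUn S) = Unary S 0"
| "gen_atom (GLoop S) = Binary S 0 0"
| "gen_atom (GOut S) = Binary S 0 1"
| "gen_atom (GIn S) = Binary S 1 0"

definition fresh_name :: "tgd set \<Rightarrow> cq \<Rightarrow> pname" where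
  "fresh_name T q = (LEAST S. S \<notin> (\<Union>\<alpha>\<in>ontology_atoms T \<union> atoms q. un_names \<alpha>))"

text \<open>The constant \<open>a\<close> is 0.\<close>

definition gen_model :: "tgd set \<Rightarrow> cq \<Rightarrow> gen \<Rightarrow> elem atom set" where
  "gen_model T q \<rho> =
     canonical (insert (TGD (Unary (fresh_name T q) 0) [gen_atom \<rho>]) T) {Unary (fresh_name T q) 0}"

definition tw_atoms :: "cq \<Rightarrow> var set \<times> var set \<Rightarrow> var atom set" where
  "tw_atoms q = (\<lambda>(tr, ti). {\<alpha> \<in> atoms q. terms \<alpha> \<subseteq> tr \<union> ti \<and> \<not> terms \<alpha> \<subseteq> tr})"

definition tw_hom ::
  "tgd set \<Rightarrow> cq \<Rightarrow> gen \<Rightarrow> (var \<Rightarrow> elem) \<Rightarrow> var set \<times> var set \<Rightarrow> bool" where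
  "tw_hom T q \<rho> h = (\<lambda>(tr, ti).
     tr \<subseteq> cq_vars q \<and> tr \<inter> ti = {} \<and> ti \<noteq> {} \<and> ti \<subseteq> ex_vars q \<and>
     (\<forall>\<alpha>\<in>tw_atoms q (tr, ti). map_atom h \<alpha> \<in> gen_model T q \<rho>) \<and>
     tr = {z \<in> (\<Union>\<alpha>\<in>tw_atoms q (tr, ti). terms \<alpha>). h z = Cst 0} \<and>
     (\<forall>\<alpha>\<in>atoms q. terms \<alpha> \<inter> ti \<noteq> {} \<longrightarrow> \<alpha> \<in> tw_atoms q (tr, ti)))"

text \<open>
  Minimality refers to the homomorphism at hand: no proper subset of the atoms of the tree witness
  has the required properties with respect to the restriction of the same \<open>h\<close>. If the
  homomorphism were allowed to change, a tree witness could be discarded in favour of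
  a smaller one that folds more variables onto the root, and the tree-witness rewriting
  would be incomplete.
\<close>

definition tree_witness_by :: "tgd set \<Rightarrow> cq \<Rightarrow> gen \<Rightarrow> var set \<times> var set \<Rightarrow> bool" where
  "tree_witness_by T q \<rho> t \<longleftrightarrow>
     (\<exists>h. tw_hom T q \<rho> h t \<and> \<not> (\<exists>t'. tw_hom T q \<rho> h t' \<and> tw_atoms q t' \<subset> tw_atoms q t))"

definition tree_witnesses :: "tgd set \<Rightarrow> cq \<Rightarrow> (var set \<times> var set) set" where
  "tree_witnesses T q = {t. \<exists>\<rho>\<in>gens T. tree_witness_by T q \<rho> t}"

text \<open>The maximum is 0 if there are no existential variables.\<close>

definition tw_degree :: "tgd set \<Rightarrow> cq \<Rightarrow> nat" where
  "tw_degree T q =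
     1 + Max (insert 0 ((\<lambda>z. card {t \<in> tree_witnesses T q. z \<in> snd t}) ` ex_vars q))"

end

theory Submission
  imports Defs "HOL-Library.Countable"
begin

text \<open>
  The formula is built by divide and conquer. In a subquery in which some variables are already fixed
  to constants, pick an existential variable \<open>z\<close> whose removal leaves components with at most half
  of the existential variables. Either \<open>z\<close> is mapped to a constant, or it lies in the interior of
  one of at most \<open>d - 1\<close> tree witnesses, whose roots are then mapped to a single constant that
  satisfies a generator. In each of these \<open>d\<close> cases the query falls apart into
  independent subqueries of half the size, so \<open>log n\<close> levels multiply the \<open>n\<close> atoms
  by \<open>d powr log n = n powr log d\<close>. The roots of a tree witness are at most as many as the atoms
  that it covers, which pays for the equalities between them.

  To obtain the bound without a further constant factor, subqueries with one existential variable are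
  treated as leaves, and a tree with \<open>n\<close> atoms and \<open>n + 1 = 2 ^ k\<close> existential variables, for which
  halving takes one level too many, is split by hand.
\<close>

subsection \<open>The canonical model\<close>

text \<open>The bound of two variables per tgd shapes the canonical model. A tgd that creates a null
  has a one-variable body, so every null has a single parent and the nulls form trees hanging off
  single constants. A connected set of variables mapped to nulls therefore stays in one such tree,
  and the neighbouring variables mapped to constants all go to the constant at its root. This is why
  one class of equalities and one generator atom record everything about a tree witness. The size
  bounds of the recursion have the form k times the number of atoms, because only these add up
  exactly when a query falls apart. The budget is tight. With 2^D <= n < 2^(D+1), the factor
  \<open>n powr log 2 d\<close> pays for D levels only, while a tree with n atoms may have n + 1
  variables. A leaf with one open variable still needs up to two disjuncts; they are paid for by the
  factor 2 between |T| and the number of generators rather than by a factor d.\<close>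

instance atom :: (countable) countable by countable_datatype
instance tgd :: countable by countable_datatype
instance elem :: countable by countable_datatype

lemma finite_terms [simp]: "finite (terms \<alpha>)"
  by (cases \<alpha>) auto

lemma terms_nonempty [simp]: "terms \<alpha> \<noteq> {}"
  by (cases \<alpha>) auto

lemma card_terms_le_2: "card (terms \<alpha>) \<le> 2"
  by (cases \<alpha>) (auto simp: card_insert_if)

section \<open>Universality of the canonical model\<close>

lemma canonical_sat_tgd:
  assumes "\<tau> \<in> T"
  shows "sat_tgd UNIV (canonical T A) \<tau>"
  unfolding sat_tgd_def
proof (intro allI impI, elim conjE)
  fix \<sigma>
  assume *: "map_atom \<sigma> (body \<tau>) \<in> canonical T A"
  show "\<exists>\<sigma>'. (\<forall>v\<in>terms (body \<tau>). \<sigma>' v = \<sigma> v) \<and> \<sigma>' ` tgd_vars \<tau> \<subseteq> UNIV \<and>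
         (\<forall>\<psi>\<in>set (head \<tau>). map_atom \<sigma>' \<psi> \<in> canonical T A)"
    using canonical.fire[OF assms refl *]
    by (intro exI[of _ "\<lambda>v. if v \<in> terms (body \<tau>) then \<sigma> v
          else Null \<tau> (map_atom \<sigma> (body \<tau>)) v"]) auto
qed

lemma canonical_is_model: "is_model UNIV (canonical T A) Cst T A"
  by (auto simp: is_model_def canonical_sat_tgd intro: canonical.data)

text \<open>Entailment quantifies only over domains inside the natural numbers. The canonical model,
  whose elements have type \<open>elem\<close>, can be tested only through an injective
  copy.\<close>

lemma is_model_inj_image:
  assumes "is_model UNIV F c T A" and "inj f"
  shows "is_model (range f) (map_atom f ` F) (f \<circ> c) T A"
proof -
  have inv: "inv f (f x) = x" for x
    using assms(2) by simp
  have "sat_tgd (range f) (map_atom f ` F) \<tau>" if "\<tau> \<in> T" for \<tau>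
    unfolding sat_tgd_def
  proof (intro allI impI, elim conjE)
    fix \<sigma>
    assume D: "\<sigma> ` terms (body \<tau>) \<subseteq> range f"
      and "map_atom \<sigma> (body \<tau>) \<in> map_atom f ` F"
    then obtain \<beta> where \<beta>: "\<beta> \<in> F" "map_atom \<sigma> (body \<tau>) = map_atom f \<beta>"
      by blast
    have "map_atom (inv f \<circ> \<sigma>) (body \<tau>) = map_atom (inv f) (map_atom f \<beta>)"
      by (simp add: \<beta>(2)[symmetric] atom.map_comp)
    also have "\<dots> = \<beta>"
      by (simp add: atom.map_comp comp_def inv atom.map_ident)
    finally have "map_atom (inv f \<circ> \<sigma>) (body \<tau>) \<in> F"
      using \<beta>(1) by simp
    moreover have "sat_tgd UNIV F \<tau>"
      using assms(1) that by (auto simp: is_model_def)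
    ultimately obtain \<sigma>' where \<sigma>': "\<forall>v\<in>terms (body \<tau>). \<sigma>' v = inv f (\<sigma> v)"
      "\<forall>\<psi>\<in>set (head \<tau>). map_atom \<sigma>' \<psi> \<in> F"
      by (auto simp: sat_tgd_def)
    have "f (\<sigma>' v) = \<sigma> v" if "v \<in> terms (body \<tau>)" for v
    proof -
      have "\<sigma> v \<in> range f" using D that by blast
      then show ?thesis using \<sigma>'(1) that by (simp add: f_inv_into_f)
    qed
    then show "\<exists>\<sigma>'. (\<forall>v\<in>terms (body \<tau>). \<sigma>' v = \<sigma> v) \<and> \<sigma>' ` tgd_vars \<tau> \<subseteq> range f \<and>
           (\<forall>\<psi>\<in>set (head \<tau>). map_atom \<sigma>' \<psi> \<in> map_atom f ` F)"
      using \<sigma>'(2) by (intro exI[of _ "f \<circ> \<sigma>'"]) (auto simp: atom.map_comp[symmetric])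
  qed
  then show ?thesis
    using assms(1) by (auto simp: is_model_def atom.set_map atom.map_comp[symmetric])
qed

text \<open>A null stores the atom that fired its tgd, so the homomorphism can be defined by
  recursion on elements: the value of a null is a witness that the model provides for the image of
  the stored atom.\<close>

lemma canonical_hom_model:
  assumes M: "is_model D F c T A"
  obtains g where "g \<circ> Cst = c" "range g \<subseteq> D" "\<forall>\<alpha>\<in>canonical T A. map_atom g \<alpha> \<in> F"
proof -
  \<comment> \<open>\<open>ok\<close> says that \<open>w\<close> supplies the existential witnesses
    of \<open>\<tau>\<close> for the body image \<open>\<beta>\<close>. Quantifying over every
    matching \<open>\<sigma>\<close> is harmless, as \<open>\<beta>\<close> determines
    \<open>\<sigma>\<close> on the body, and it makes one choice of \<open>w\<close> serve each
    firing on \<open>\<beta>\<close>.\<close>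
  define ok where "ok \<tau> \<beta> w \<longleftrightarrow> (\<forall>\<sigma>. \<beta> = map_atom \<sigma> (body \<tau>) \<longrightarrow>
      w ` tgd_vars \<tau> \<subseteq> D \<and>
      (\<forall>\<psi>\<in>set (head \<tau>). map_atom (\<lambda>v. if v \<in> terms (body \<tau>) then \<sigma> v else w v) \<psi> \<in> F))"
    for \<tau> \<beta> w
  obtain d0 where d0: "d0 \<in> D" using M by (auto simp: is_model_def)
  have ex_ok: "\<exists>w. ok \<tau> \<beta> w" if \<tau>: "\<tau> \<in> T" and \<beta>: "\<beta> \<in> F" for \<tau> \<beta>
  proof (cases "\<exists>\<sigma>. \<beta> = map_atom \<sigma> (body \<tau>)")
    case True
    then obtain \<sigma> where \<sigma>: "\<beta> = map_atom \<sigma> (body \<tau>)" by blast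
    have "terms \<beta> \<subseteq> D"
      using M \<beta> by (simp add: is_model_def)
    then have "\<sigma> ` terms (body \<tau>) \<subseteq> D \<and> map_atom \<sigma> (body \<tau>) \<in> F"
      using \<beta> \<sigma> by (simp add: atom.set_map)
    moreover have "sat_tgd D F \<tau>"
      using M \<tau> by (auto simp: is_model_def)
    ultimately obtain \<sigma>' where \<sigma>': "\<forall>v\<in>terms (body \<tau>). \<sigma>' v = \<sigma> v" "\<sigma>' ` tgd_vars \<tau> \<subseteq> D"
      "\<forall>\<psi>\<in>set (head \<tau>). map_atom \<sigma>' \<psi> \<in> F"
      unfolding sat_tgd_def by metis
    have "ok \<tau> \<beta> \<sigma>'"
      unfolding ok_def
    proof (intro allI impI conjI ballI)
      fix \<sigma>2 \<psi>
      assume *: "\<beta> = map_atom \<sigma>2 (body \<tau>)" "\<psi> \<in> set (head \<tau>)"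
      have "\<sigma>2 v = \<sigma>' v" if "v \<in> terms (body \<tau>)" for v
        using that *(1) \<sigma> \<sigma>'(1) by (cases "body \<tau>") auto
      then have "(\<lambda>v. if v \<in> terms (body \<tau>) then \<sigma>2 v else \<sigma>' v) = \<sigma>'" by auto
      then show "map_atom (\<lambda>v. if v \<in> terms (body \<tau>) then \<sigma>2 v else \<sigma>' v) \<psi> \<in> F"
        using \<sigma>'(3) *(2) by auto
    qed (use \<sigma>'(2) in blast)
    then show ?thesis by blast
  next
    case False
    then show ?thesis by (auto simp: ok_def)
  qed
  define W where "W \<tau> \<beta> = (SOME w. ok \<tau> \<beta> w)" for \<tau> \<beta>
  \<comment> \<open>\<open>rec_elem\<close> pairs each term of the stored atom with its recursive
    value, hence \<open>map_atom snd\<close>. The default \<open>d0\<close> keeps the range inside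
    \<open>D\<close> for nulls that never arise in the chase, where \<open>W\<close> is
    arbitrary.\<close>
  define g where "g = rec_elem c (\<lambda>\<tau> \<beta> v. let x = W \<tau> (map_atom snd \<beta>) v in if x \<in> D then x else d0)"
  have g_Cst: "g (Cst a) = c a" for a
    by (simp add: g_def)
  have g_Null: "g (Null \<tau> \<beta> v) =
      (let x = W \<tau> (map_atom g \<beta>) v in if x \<in> D then x else d0)" for \<tau> \<beta> v
    by (simp add: g_def atom.map_comp comp_def)
  have gD: "range g \<subseteq> D"
  proof (rule image_subsetI)
    fix e show "g e \<in> D"
      using M d0 by (cases e) (auto simp: g_Cst g_Null is_model_def Let_def range_subsetD)
  qed
  have "map_atom g \<alpha> \<in> F" if "\<alpha> \<in> canonical T A" for \<alpha>
    using that
  proof induction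
    case (data \<alpha>)
    then show ?case
      using M by (simp add: is_model_def atom.map_comp comp_def g_Cst)
  next
    case (fire \<tau> \<beta> \<sigma> \<psi>)
    have ok: "ok \<tau> (map_atom g \<beta>) (W \<tau> (map_atom g \<beta>))"
      unfolding W_def using ex_ok fire by (metis someI_ex)
    have \<beta>: "map_atom g \<beta> = map_atom (g \<circ> \<sigma>) (body \<tau>)"
      using fire by (simp add: atom.map_comp)
    have W: "W \<tau> (map_atom g \<beta>) v \<in> D" if "v \<in> terms \<psi>" for v
      using ok \<beta> that fire(4) unfolding ok_def tgd_vars_def by blast
    have "map_atom (\<lambda>v. if v \<in> terms (body \<tau>) then (g \<circ> \<sigma>) v else W \<tau> (map_atom g \<beta>) v) \<psi> \<in> F"
      using ok \<beta> fire(4) unfolding ok_def by blast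
    also have "map_atom (\<lambda>v. if v \<in> terms (body \<tau>) then (g \<circ> \<sigma>) v else W \<tau> (map_atom g \<beta>) v) \<psi> =
        map_atom g (map_atom (\<lambda>v. if v \<in> terms (body \<tau>) then \<sigma> v else Null \<tau> \<beta> v) \<psi>)"
      unfolding atom.map_comp using W by (intro atom.map_cong0) (auto simp: g_Null Let_def)
    finally show ?case .
  qed
  then show ?thesis
    using that[of g] g_Cst gD by (auto simp: fun_eq_iff)
qed

lemma canonical_Cst_ind:
  assumes "\<alpha> \<in> canonical T A" and "Cst c \<in> terms \<alpha>"
  shows "c \<in> ind A"
  using assms
proof induction
  case (data \<alpha>)
  then show ?case by (auto simp: ind_def atom.set_map)
next
  case (fire \<tau> \<beta> \<sigma> \<psi>)
  then show ?case by (force simp: atom.set_map split: if_splits)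
qed

text \<open>This is where completeness of the data enters: an atom over constants in the canonical
  model holds in every model, hence is entailed. It allows fully fixed atoms to be rewritten to
  themselves.\<close>

lemma canonical_ground_iff:
  assumes "complete_data T A"
  shows "map_atom Cst \<alpha> \<in> canonical T A \<longleftrightarrow> \<alpha> \<in> A"
proof
  assume *: "map_atom Cst \<alpha> \<in> canonical T A"
  have "entails_atom T A \<alpha>"
    unfolding entails_atom_def
  proof (intro allI impI)
    fix D F c assume "is_model (D :: nat set) F c T A"
    then obtain g where "g \<circ> Cst = c" "range g \<subseteq> D" "\<forall>\<alpha>\<in>canonical T A. map_atom g \<alpha> \<in> F"
      by (rule canonical_hom_model)
    with * show "map_atom c \<alpha> \<in> F" by (metis atom.map_comp)
  qed
  moreover have "terms \<alpha> \<subseteq> ind A"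
    using canonical_Cst_ind[OF *] by (auto simp: atom.set_map)
  ultimately show "\<alpha> \<in> A" using assms by (auto simp: complete_data_def)
qed (rule canonical.data)

lemma entails_cq_iff_canonical:
  "entails_cq T A q as \<longleftrightarrow>
    (\<exists>h. map h (ans q) = map Cst as \<and> (\<forall>\<alpha>\<in>atoms q. map_atom h \<alpha> \<in> canonical T A))"
proof
  assume *: "entails_cq T A q as"
  have "is_model (range (to_nat :: elem \<Rightarrow> nat)) (map_atom to_nat ` canonical T A) (to_nat \<circ> Cst) T A"
    by (rule is_model_inj_image[OF canonical_is_model]) simp
  with * obtain \<sigma> where \<sigma>: "map \<sigma> (ans q) = map (to_nat \<circ> Cst) as"
    "\<forall>\<alpha>\<in>atoms q. map_atom \<sigma> \<alpha> \<in> map_atom to_nat ` canonical T A"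
    unfolding entails_cq_def by blast
  let ?h = "from_nat \<circ> \<sigma> :: var \<Rightarrow> elem"
  have "map ?h (ans q) = map from_nat (map (to_nat \<circ> Cst) as)"
    by (simp add: \<sigma>(1)[symmetric])
  then have "map ?h (ans q) = map Cst as" by simp
  moreover have "map_atom ?h \<alpha> \<in> canonical T A" if \<alpha>: "\<alpha> \<in> atoms q" for \<alpha>
  proof -
    obtain \<beta> where "\<beta> \<in> canonical T A" "map_atom \<sigma> \<alpha> = map_atom to_nat \<beta>"
      using \<sigma>(2) \<alpha> by blast
    then show ?thesis
      by (simp add: atom.map_comp[symmetric]) (simp add: atom.map_comp comp_def atom.map_ident)
  qed
  ultimately show "\<exists>h. map h (ans q) = map Cst as \<and> (\<forall>\<alpha>\<in>atoms q. map_atom h \<alpha> \<in> canonical T A)"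
    by blast
next
  assume "\<exists>h. map h (ans q) = map Cst as \<and> (\<forall>\<alpha>\<in>atoms q. map_atom h \<alpha> \<in> canonical T A)"
  then obtain h where h: "map h (ans q) = map Cst as"
    "\<forall>\<alpha>\<in>atoms q. map_atom h \<alpha> \<in> canonical T A" by blast
  show "entails_cq T A q as"
    unfolding entails_cq_def
  proof (intro allI impI)
    fix D F c assume "is_model (D :: nat set) F c T A"
    then obtain g where g: "g \<circ> Cst = c" "range g \<subseteq> D"
      "\<forall>\<alpha>\<in>canonical T A. map_atom g \<alpha> \<in> F"
      by (rule canonical_hom_model)
    have "map (g \<circ> h) (ans q) = map c as"
      using h(1) g(1) by (metis map_map)
    then show "\<exists>\<sigma>. \<sigma> ` cq_vars q \<subseteq> D \<and> map \<sigma> (ans q) = map c as \<and>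
                (\<forall>\<alpha>\<in>atoms q. map_atom \<sigma> \<alpha> \<in> F)"
      using h(2) g by (intro exI[of _ "g \<circ> h"]) (auto simp: atom.map_comp[symmetric])
  qed
qed

section \<open>Renaming of constants and the trees of nulls\<close>

lemma canonical_mono:
  assumes "A \<subseteq> A'" and "T \<subseteq> T'"
  shows "canonical T A \<subseteq> canonical T' A'"
proof
  fix \<alpha> assume "\<alpha> \<in> canonical T A"
  then show "\<alpha> \<in> canonical T' A'"
    by induction (use assms in \<open>auto intro: canonical.intros\<close>)
qed

text \<open>Nulls contain constants in their stored atoms, so renaming must act inside them too. It
  is used with constant maps, to carry the tree generated at one constant to another.\<close>

primrec rename :: "(const \<Rightarrow> const) \<Rightarrow> elem \<Rightarrow> elem" where
  "rename f (Cst c) = Cst (f c)"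
| "rename f (Null \<tau> \<beta> v) = Null \<tau> (map_atom (rename f) \<beta>) v"

lemma rename_canonical:
  assumes "\<alpha> \<in> canonical T A"
  shows "map_atom (rename f) \<alpha> \<in> canonical T (map_atom f ` A)"
  using assms
proof induction
  case (data \<alpha>)
  then have "map_atom Cst (map_atom f \<alpha>) \<in> canonical T (map_atom f ` A)"
    by (intro canonical.data) auto
  then show ?case by (simp add: atom.map_comp comp_def)
next
  case (fire \<tau> \<beta> \<sigma> \<psi>)
  let ?\<beta> = "map_atom (rename f) \<beta>"
  have "map_atom (\<lambda>v. if v \<in> terms (body \<tau>) then (rename f \<circ> \<sigma>) v else Null \<tau> ?\<beta> v) \<psi>
      \<in> canonical T (map_atom f ` A)"
    using fire by (intro canonical.fire[where \<sigma> = "rename f \<circ> \<sigma>"]) (simp_all add: atom.map_comp)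
  also have "map_atom (\<lambda>v. if v \<in> terms (body \<tau>) then (rename f \<circ> \<sigma>) v else Null \<tau> ?\<beta> v) \<psi> =
    map_atom (rename f) (map_atom (\<lambda>v. if v \<in> terms (body \<tau>) then \<sigma> v else Null \<tau> \<beta> v) \<psi>)"
    unfolding atom.map_comp by (intro atom.map_cong0) auto
  finally show ?case .
qed

text \<open>The reflexive ancestor order of the chase, read off the stored atoms: a null descends
  from itself and from the ancestors of any term of the atom that created it.\<close>

inductive below :: "elem \<Rightarrow> elem \<Rightarrow> bool" for N where
  below_refl: "below N N"
| below_step: "x \<in> terms \<beta> \<Longrightarrow> below N x \<Longrightarrow> below N (Null \<tau> \<beta> v)"

lemma not_below_Cst: "below (Null \<tau> \<beta> v) (Cst c) \<Longrightarrow> False"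
  by (cases rule: below.cases) auto

text \<open>The body takes at least one of the two variables, and an existential variable takes the
  other.\<close>

lemma wf_tgd_existential:
  assumes "wf_tgd \<tau>" and "\<psi> \<in> set (head \<tau>)" and "v \<in> terms \<psi>" and "v \<notin> terms (body \<tau>)"
  obtains x where "terms (body \<tau>) = {x}"
    "\<And>\<psi>' v'. \<psi>' \<in> set (head \<tau>) \<Longrightarrow> v' \<in> terms \<psi>' \<Longrightarrow> v' \<notin> terms (body \<tau>) \<Longrightarrow> v' = v"
proof -
  obtain x where x: "x \<in> terms (body \<tau>)"
    by (metis terms_nonempty ex_in_conv)
  have fin: "finite (tgd_vars \<tau>)"
    by (auto simp: tgd_vars_def)
  have sub: "{x, v} \<subseteq> tgd_vars \<tau>"
    using x assms by (auto simp: tgd_vars_def)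
  have "card {x, v} = 2" using x assms by (metis card_2_iff)
  then have vars: "tgd_vars \<tau> = {x, v}"
    using card_seteq[OF fin sub] assms(1) by (simp add: wf_tgd_def)
  have "terms (body \<tau>) = {x}"
    using vars x assms(4) by (auto simp: tgd_vars_def)
  moreover have "v' = v" if "\<psi>' \<in> set (head \<tau>)" "v' \<in> terms \<psi>'" "v' \<notin> terms (body \<tau>)" for \<psi>' v'
    using that vars x by (auto simp: tgd_vars_def)
  ultimately show thesis using that by blast
qed

text \<open>An atom that reaches below \<open>N\<close> has two possible origins. Either the firing
  used an atom already reaching below \<open>N\<close>, and then its new null is below
  \<open>N\<close> as well; or the firing created \<open>N\<close> itself, from an atom whose only
  term is \<open>c\<close>. So the subtree is derived from that atom alone and touches the rest of
  the model only in \<open>c\<close>.\<close>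

lemma below_subtree:
  assumes "ontology T" and "\<alpha> \<in> canonical T A" and "e \<in> terms \<alpha>" and "below N e"
    and N: "N = Null \<tau> (map_atom Cst \<beta>) v" and \<beta>: "terms \<beta> = {c}"
  shows "\<alpha> \<in> canonical T {\<beta>} \<and> (\<forall>e'\<in>terms \<alpha>. below N e' \<or> e' = Cst c)"
  using assms(2-4)
proof (induction arbitrary: e)
  case (data \<alpha>)
  then show ?case using not_below_Cst N by (auto simp: atom.set_map)
next
  case (fire \<tau>' \<beta>' \<sigma> \<psi>)
  define g where "g = (\<lambda>v. if v \<in> terms (body \<tau>') then \<sigma> v else Null \<tau>' \<beta>' v)"
  have terms\<beta>': "terms \<beta>' = \<sigma> ` terms (body \<tau>')"
    using fire by (simp add: atom.set_map)
  have "map_atom g \<psi> \<in> canonical T {\<beta>} \<and>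
      (\<forall>e'\<in>terms (map_atom g \<psi>). below N e' \<or> e' = Cst c)"
  proof (cases "\<exists>x\<in>terms \<beta>'. below N x")
    case True
    then obtain x where x: "x \<in> terms \<beta>'" "below N x" by blast
    with fire have IH: "\<beta>' \<in> canonical T {\<beta>}" "\<forall>e'\<in>terms \<beta>'. below N e' \<or> e' = Cst c" by blast+
    have "map_atom g \<psi> \<in> canonical T {\<beta>}"
      unfolding g_def using fire IH by (intro canonical.fire[where \<sigma> = \<sigma>]) simp_all
    moreover have "below N (g v) \<or> g v = Cst c" for v
      using IH(2) below_step[OF x] terms\<beta>' by (auto simp: g_def)
    ultimately show ?thesis by (auto simp: atom.set_map)
  next
    case False
    from fire.prems obtain w where w: "w \<in> terms \<psi>" "e = g w" by (auto simp: atom.set_map g_def)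
    have wn: "w \<notin> terms (body \<tau>')"
      using False fire.prems w terms\<beta>' by (auto simp: g_def)
    with w fire.prems have "below N (Null \<tau>' \<beta>' w)" by (simp add: g_def)
    then have "N = Null \<tau>' \<beta>' w"
      using False by (cases rule: below.cases) auto
    then have eqs: "\<tau>' = \<tau>" "\<beta>' = map_atom Cst \<beta>" "w = v" using N by auto
    have "wf_tgd \<tau>'" using assms(1) fire by (auto simp: ontology_def)
    then have only_w: "w' = w" if "w' \<in> terms \<psi>" "w' \<notin> terms (body \<tau>')" for w'
      using wf_tgd_existential[OF _ fire.hyps(4) w(1) wn] that fire.hyps(4) by metis
    have "\<beta>' \<in> canonical T {\<beta>}"
      unfolding eqs(2) by (intro canonical.data) simp
    then have "map_atom g \<psi> \<in> canonical T {\<beta>}"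
      unfolding g_def using fire by (intro canonical.fire[where \<sigma> = \<sigma>]) simp_all
    moreover have "below N (g w') \<or> g w' = Cst c" if "w' \<in> terms \<psi>" for w'
    proof (cases "w' \<in> terms (body \<tau>')")
      case True
      then have "\<sigma> w' \<in> terms \<beta>'" using terms\<beta>' by auto
      then show ?thesis using True eqs(2) \<beta> by (auto simp: atom.set_map g_def)
    next
      case False
      then show ?thesis using only_w that eqs N by (auto simp: g_def intro: below_refl)
    qed
    ultimately show ?thesis by (auto simp: atom.set_map)
  qed
  then show ?case by (simp add: g_def)
qed

text \<open>Following stored atoms from a null back towards the data must end, and it ends at an
  atom over one constant, since bodies of null-creating tgds have one variable.\<close>

lemma canonical_null_root:
  assumes "ontology T" and "\<alpha> \<in> canonical T A" and "e \<in> terms \<alpha>" and "\<And>c. e \<noteq> Cst c"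
  obtains \<tau> v c where "\<tau> \<in> T" "map_atom Cst (map_atom (\<lambda>_. c) (body \<tau>)) \<in> canonical T A"
    "below (Null \<tau> (map_atom Cst (map_atom (\<lambda>_. c) (body \<tau>))) v) e"
proof -
  have "\<exists>\<tau> v c. \<tau> \<in> T \<and> map_atom Cst (map_atom (\<lambda>_. c) (body \<tau>)) \<in> canonical T A \<and>
    below (Null \<tau> (map_atom Cst (map_atom (\<lambda>_. c) (body \<tau>))) v) e"
    using assms(2-4)
  proof (induction arbitrary: e)
    case (data \<alpha>)
    then show ?case by (auto simp: atom.set_map)
  next
    case (fire \<tau> \<beta> \<sigma> \<psi>)
    have terms\<beta>: "terms \<beta> = \<sigma> ` terms (body \<tau>)"
      using fire by (simp add: atom.set_map)
    from fire.prems(1) obtain w where w: "w \<in> terms \<psi>"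
      "e = (if w \<in> terms (body \<tau>) then \<sigma> w else Null \<tau> \<beta> w)" by (auto simp: atom.set_map)
    show ?case
    proof (cases "w \<in> terms (body \<tau>)")
      case True
      then have "e \<in> terms \<beta>" using w terms\<beta> by auto
      then show ?thesis using fire by blast
    next
      case False
      have "wf_tgd \<tau>" using assms(1) fire by (auto simp: ontology_def)
      then obtain x where x: "terms (body \<tau>) = {x}"
        using wf_tgd_existential[OF _ fire.hyps(4) w(1) False] by metis
      show ?thesis
      proof (cases "\<sigma> x")
        case (Cst c)
        have "\<beta> = map_atom Cst (map_atom (\<lambda>_. c) (body \<tau>))"
          unfolding fire.hyps(2) atom.map_comp using x Cst by (intro atom.map_cong0) auto
        then show ?thesis
          using fire.hyps w(2) False by (auto intro: below_refl)
      next
        case (Null \<tau>' \<beta>' v')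
        have "\<sigma> x \<in> terms \<beta>" using terms\<beta> x by auto
        moreover have "\<And>c. \<sigma> x \<noteq> Cst c" using Null by simp
        ultimately obtain \<tau>2 v2 c where "\<tau>2 \<in> T"
          "map_atom Cst (map_atom (\<lambda>_. c) (body \<tau>2)) \<in> canonical T A"
          "below (Null \<tau>2 (map_atom Cst (map_atom (\<lambda>_. c) (body \<tau>2))) v2) (\<sigma> x)"
          using fire.IH by blast
        then show ?thesis
          using below_step[OF \<open>\<sigma> x \<in> terms \<beta>\<close>] w(2) False by metis
      qed
    qed
  qed
  then show ?thesis using that by blast
qed

subsection \<open>Separators in forests\<close>

definition component :: "('v \<times> 'v) set \<Rightarrow> 'v set \<Rightarrow> 'v \<Rightarrow> 'v set" where
  "component E W u = (E \<inter> W \<times> W)\<^sup>* `` {u}"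

text \<open>The cycle condition of \<open>is_tree\<close> without a vertex set, so that it can be
  used unchanged while vertices are being removed.\<close>

definition acyclic_graph :: "('v \<times> 'v) set \<Rightarrow> bool" where
  "acyclic_graph E \<longleftrightarrow>
     \<not> (\<exists>c. length c \<ge> 3 \<and> distinct c \<and> successively (\<lambda>u v. (u, v) \<in> E) c \<and> (last c, hd c) \<in> E)"

lemma component_refl [simp]: "u \<in> component E W u"
  by (simp add: component_def)

lemma component_least:
  assumes "u \<in> X" and "\<And>x y. x \<in> X \<Longrightarrow> x \<in> W \<Longrightarrow> y \<in> W \<Longrightarrow> (x, y) \<in> E \<Longrightarrow> y \<in> X"
  shows "component E W u \<subseteq> X"
proof
  fix v assume "v \<in> component E W u"
  then have "(u, v) \<in> (E \<inter> W \<times> W)\<^sup>*" by (simp add: component_def)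
  then show "v \<in> X" by induction (use assms in auto)
qed

lemma component_subset: "u \<in> W \<Longrightarrow> component E W u \<subseteq> W"
  by (rule component_least)

lemma component_closed:
  assumes "x \<in> component E W u" and "(x, y) \<in> E" and "x \<in> W" and "y \<in> W"
  shows "y \<in> component E W u"
  using assms unfolding component_def by (auto intro: rtrancl_into_rtrancl)

lemma component_mono: "W \<subseteq> W' \<Longrightarrow> component E W u \<subseteq> component E W' u"
  unfolding component_def by (intro Image_mono rtrancl_mono) auto

lemma rtrancl_distinct_path:
  assumes "(u, v) \<in> R\<^sup>*"
  obtains p where "p \<noteq> []" "hd p = u" "last p = v" "distinct p"
    "successively (\<lambda>x y. (x, y) \<in> R) p"
proof -
  have "\<exists>p. p \<noteq> [] \<and> hd p = u \<and> last p = v \<and> distinct p \<and> successively (\<lambda>x y. (x, y) \<in> R) p"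
    using assms
  proof induction
    case base
    show ?case by (intro exI[of _ "[u]"]) auto
  next
    case (step y z)
    then obtain p where p: "p \<noteq> []" "hd p = u" "last p = y" "distinct p"
      "successively (\<lambda>x y. (x, y) \<in> R) p" by blast
    show ?case
    proof (cases "z \<in> set p")
      case True
      then obtain p1 p2 where "p = p1 @ z # p2" by (auto dest: split_list)
      with p show ?thesis
        by (intro exI[of _ "p1 @ [z]"]) (auto simp: successively_append_iff hd_append)
    next
      case False
      with p step show ?thesis
        by (intro exI[of _ "p @ [z]"]) (auto simp: successively_append_iff)
    qed
  qed
  then show thesis using that by blast
qed

lemma successively_subset:
  assumes "successively (\<lambda>u v. (u, v) \<in> E) c" and "E \<subseteq> V \<times> V" and "length c \<ge> 2"
  shows "set c \<subseteq> V"
  using assms(1,3)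
proof (induction c)
  case (Cons a c)
  then show ?case using assms(2) by (cases c; cases "tl c") auto
qed simp

text \<open>Two distinct neighbours of \<open>z\<close> in one component are joined by a simple path
  that avoids \<open>z\<close>; adding \<open>z\<close> closes it to a cycle.\<close>

lemma acyclic_unique_neighbour:
  assumes E: "acyclic_graph E" "sym E" and z: "z \<notin> W" and u: "u \<in> W"
    and w: "w \<in> component E W u" "(z, w) \<in> E" and w': "w' \<in> component E W u" "(z, w') \<in> E"
  shows "w = w'"
proof (rule ccontr)
  assume ne: "w \<noteq> w'"
  let ?R = "E \<inter> W \<times> W"
  have "sym ?R" using E(2) by (auto simp: sym_def)
  then have "(w, u) \<in> ?R\<^sup>*"
    using w(1) by (auto simp: component_def dest: symD[OF sym_rtrancl])
  moreover have "(u, w') \<in> ?R\<^sup>*" using w'(1) by (auto simp: component_def)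
  ultimately have "(w, w') \<in> ?R\<^sup>*" by (rule rtrancl_trans)
  then obtain p where p: "p \<noteq> []" "hd p = w" "last p = w'" "distinct p"
    "successively (\<lambda>x y. (x, y) \<in> ?R) p"
    by (rule rtrancl_distinct_path)
  obtain x y r where xyr: "p = x # y # r"
    using p(1-3) ne by (cases p; cases "tl p") auto
  have "set p \<subseteq> W"
    using successively_subset[OF p(5)] xyr by auto
  then have "distinct (z # p)" using p(4) z by auto
  moreover have "successively (\<lambda>x y. (x, y) \<in> E) p"
    using p(5) by (rule successively_mono) auto
  then have "successively (\<lambda>x y. (x, y) \<in> E) (z # p)"
    using p w(2) xyr by auto
  moreover have "(last (z # p), hd (z # p)) \<in> E"
    using p(1,3) w'(2) E(2) by (auto dest: symD)
  moreover have "length (z # p) \<ge> 3" using xyr by simp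
  ultimately show False using E(1) unfolding acyclic_graph_def by blast
qed

text \<open>Suppose every vertex leaves a component \<open>C\<close> with more than half of the
  vertices. Step from \<open>z\<close> to its only neighbour in \<open>C\<close>. The oversized
  component there cannot lie outside \<open>C\<close>, where fewer than half of the vertices remain,
  so it is a proper part of \<open>C\<close>. Such steps cannot go on forever.\<close>

lemma forest_separator:
  fixes U :: "'v set"
  assumes E: "acyclic_graph E" "sym E" and U: "finite U" "U \<noteq> {}"
  obtains z where "z \<in> U" "\<forall>u\<in>U - {z}. 2 * card (component E (U - {z}) u) \<le> card U"
proof -
  have False if bad: "\<forall>z\<in>U. \<exists>u\<in>U - {z}. card U < 2 * card (component E (U - {z}) u)"
  proof -
    have False if "z \<in> U" "u \<in> U - {z}" "card (component E (U - {z}) u) = k"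
      "card U < 2 * k" for z u k
      using that
    proof (induction k arbitrary: z u rule: less_induct)
      case (less k)
      let ?C = "component E (U - {z}) u"
      have CU: "?C \<subseteq> U - {z}" using less.prems by (intro component_subset)
      have finC: "finite ?C" using CU U(1) finite_subset by blast
      \<comment> \<open>If \<open>z\<close> has no neighbour in the component, any vertex of it
        serves, and \<open>u\<close> is taken: the component is then cut off from \<open>z\<close>
        anyway.\<close>
      obtain z' where z': "z' \<in> ?C" "\<And>w. w \<in> ?C \<Longrightarrow> (z, w) \<in> E \<Longrightarrow> w = z'"
      proof (cases "\<exists>w\<in>?C. (z, w) \<in> E")
        case True
        then obtain w where "w \<in> ?C" "(z, w) \<in> E" by blast
        then show thesis
          using that[of w] acyclic_unique_neighbour[OF E, of z "U - {z}" u] less.prems by blast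
      next
        case False
        then show thesis using that[of u] by auto
      qed
      then have z'U: "z' \<in> U" using CU by blast
      then obtain u' where u': "u' \<in> U - {z'}"
        "card U < 2 * card (component E (U - {z'}) u')" using bad by blast
      let ?C' = "component E (U - {z'}) u'"
      \<comment> \<open>The only edge from \<open>C\<close> to the rest of \<open>U\<close> joins
        \<open>z\<close> to \<open>z'\<close>, so once \<open>z'\<close> is removed no edge crosses
        the border of \<open>C\<close>.\<close>
      have sep: "x \<in> ?C \<longleftrightarrow> y \<in> ?C" if "(x, y) \<in> E" "x \<in> U - {z'}" "y \<in> U - {z'}" for x y
      proof -
        have "(y, x) \<in> E" using E(2) that by (auto dest: symD)
        then show ?thesis
          using that z'(2) component_closed[of _ E "U - {z}" u] CU by blast
      qed
      show False
      proof (cases "u' \<in> ?C")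
        case True
        have "?C' \<subseteq> ?C" using True sep by (intro component_least) auto
        moreover have "?C' \<subseteq> U - {z'}" using u' by (intro component_subset)
        ultimately have "?C' \<subset> ?C" using z'(1) by blast
        then have "card ?C' < k" using psubset_card_mono[OF finC] less.prems(3) by simp
        then show False using less.IH[OF _ z'U u'(1) refl u'(2)] by blast
      next
        case False
        have "?C' \<subseteq> - ?C" using False sep by (intro component_least) auto
        moreover have "?C' \<subseteq> U - {z'}" using u' by (intro component_subset)
        ultimately have "?C' \<subseteq> U - ?C" by blast
        then have "card ?C' \<le> card (U - ?C)" using U(1) by (intro card_mono) auto
        also have "\<dots> = card U - k"
          using CU finC less.prems(3) by (subst card_Diff_subset) auto
        finally show False using u'(2) less.prems(4) by linarith
      qed
    qed
    then show False using bad U(2) by blast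
  qed
  then show thesis using that by (meson not_le)
qed

text \<open>The atom \<open>f v\<close> joins \<open>v\<close> to its predecessor on a shortest path from the root \<open>z\<close>.\<close>

lemma parent_atoms:
  fixes Q :: "'t atom set"
  assumes R_def: "R = {(u, v). u \<noteq> v \<and> (\<exists>\<alpha>\<in>Q. u \<in> terms \<alpha> \<and> v \<in> terms \<alpha>)}"
    and reach: "\<And>v. v \<in> V \<Longrightarrow> (z, v) \<in> R\<^sup>*"
  obtains f where "inj_on f (V - {z})" "\<forall>v\<in>V - {z}. f v \<in> Q \<and> v \<in> terms (f v)"
    "\<forall>v\<in>V - {z}. \<forall>x\<in>terms (f v). x \<noteq> v \<longrightarrow> (x, v) \<in> R"
proof -
  define dist where "dist v = (LEAST k. (z, v) \<in> R ^^ k)" for v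
  have "\<exists>\<alpha> p. \<alpha> \<in> Q \<and> terms \<alpha> = {p, v} \<and> (p, v) \<in> R \<and> dist p < dist v" if "v \<in> V - {z}" for v
  proof -
    have ex: "\<exists>k. (z, v) \<in> R ^^ k" using reach that by (auto simp: rtrancl_power)
    then have dv: "(z, v) \<in> R ^^ dist v" unfolding dist_def by (rule LeastI_ex)
    moreover have "dist v \<noteq> 0" using dv that by (cases "dist v") auto
    ultimately obtain k p where k: "dist v = Suc k" "(z, p) \<in> R ^^ k" "(p, v) \<in> R"
      by (cases "dist v") auto
    have "dist p \<le> k" unfolding dist_def using k(2) by (rule Least_le)
    obtain \<alpha> where \<alpha>: "\<alpha> \<in> Q" "p \<in> terms \<alpha>" "v \<in> terms \<alpha>" "p \<noteq> v"
      using k(3) by (auto simp: R_def)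
    have "card {p, v} = 2" using \<alpha>(4) by simp
    then have "{p, v} = terms \<alpha>"
      using \<alpha> card_terms_le_2[of \<alpha>] by (intro card_seteq) auto
    then show ?thesis using \<alpha>(1) k \<open>dist p \<le> k\<close> by (metis le_imp_less_Suc)
  qed
  then obtain f p where fp: "\<And>v. v \<in> V - {z} \<Longrightarrow>
      f v \<in> Q \<and> terms (f v) = {p v, v} \<and> (p v, v) \<in> R \<and> dist (p v) < dist v" by metis
  \<comment> \<open>Two vertices sharing an atom would be each other's predecessor, each strictly
    closer to \<open>z\<close> than the other.\<close>
  have "inj_on f (V - {z})"
  proof (rule inj_onI, rule ccontr)
    fix v w assume vw: "v \<in> V - {z}" "w \<in> V - {z}" "f v = f w" "v \<noteq> w"
    then have "{p v, v} = {p w, w}" using fp by metis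
    then have "p v = w \<and> p w = v" using vw(4) by (auto simp: doubleton_eq_iff)
    then show False using fp[OF vw(1)] fp[OF vw(2)] by simp
  qed
  then show thesis using that[of f] fp by auto
qed

subsection \<open>Tree witnesses generated by bodies of tgds\<close>

definition avars :: "'t atom set \<Rightarrow> 't set" where
  "avars Q = (\<Union>\<alpha>\<in>Q. terms \<alpha>)"

text \<open>
  A tgd has at most two variables, so only tgds whose body has a single variable create nulls, and the generators \<open>S(x)\<close> and
  \<open>S(x,x)\<close> obtained from their bodies suffice. There are at most \<open>|T| / 2\<close> of them.
\<close>

definition body_gen :: "tgd \<Rightarrow> gen" where
  "body_gen \<tau> = (case body \<tau> of Unary S _ \<Rightarrow> GUn S | Binary S _ _ \<Rightarrow> GLoop S)"

lemma gen_atom_body_gen: "gen_atom (body_gen \<tau>) = map_atom (\<lambda>_. 0) (body \<tau>)"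
  by (cases "body \<tau>") (auto simp: body_gen_def)

lemma body_gens_subset: "body_gen ` T \<subseteq> gens T"
proof
  fix \<rho> assume "\<rho> \<in> body_gen ` T"
  then obtain \<tau> where \<tau>: "\<tau> \<in> T" "\<rho> = body_gen \<tau>" by blast
  then have "body \<tau> \<in> ontology_atoms T" by (auto simp: ontology_atoms_def)
  then show "\<rho> \<in> gens T"
    unfolding \<tau>(2) gens_def by (cases "body \<tau>") (force simp: body_gen_def)+
qed

text \<open>Heads are nonempty, so a tgd has at least two predicate occurrences. The spare factor 2
  is spent in \<open>rewritable_single_variable\<close>.\<close>

lemma card_body_gens:
  assumes "ontology T"
  shows "2 * card (body_gen ` T) \<le> ontology_size T"
proof -
  have "card (body_gen ` T) \<le> card T"
    using assms by (intro card_image_le) (auto simp: ontology_def)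
  also have "2 * card T = (\<Sum>\<tau>\<in>T. 2)" by simp
  also have "\<dots> \<le> ontology_size T"
    unfolding ontology_size_def
  proof (rule sum_mono)
    fix \<tau> assume "\<tau> \<in> T"
    then have "head \<tau> \<noteq> []" using assms by (auto simp: ontology_def wf_tgd_def)
    then show "2 \<le> 1 + length (head \<tau>)" by (cases "head \<tau>") auto
  qed
  finally show ?thesis by simp
qed

lemma un_names_map_atom [simp]: "un_names (map_atom f \<alpha>) = un_names \<alpha>"
  by (cases \<alpha>) auto

lemma finite_un_names [simp]: "finite (un_names \<alpha>)"
  by (cases \<alpha>) auto

lemma canonical_un_names:
  assumes "\<alpha> \<in> canonical T A"
  shows "un_names \<alpha> \<subseteq> (\<Union>\<alpha>\<in>A. un_names \<alpha>) \<union> (\<Union>\<alpha>\<in>ontology_atoms T. un_names \<alpha>)"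
  using assms
proof induction
  case (data \<alpha>)
  then show ?case by auto
next
  case (fire \<tau> \<beta> \<sigma> \<psi>)
  then have "\<psi> \<in> ontology_atoms T" by (auto simp: ontology_atoms_def)
  then show ?case by auto
qed

text \<open>\<open>B\<close> holds the variables already fixed to constants. Every atom of
  \<open>q\<close> on an open variable has to be in \<open>Q\<close>; hence a tree witness of
  \<open>q\<close> with interior among the open variables covers only atoms of \<open>Q\<close>, and
  the degree of \<open>q\<close> bounds the branching in all subqueries.\<close>

definition subquery :: "cq \<Rightarrow> var atom set \<Rightarrow> var set \<Rightarrow> bool" where
  "subquery q Q B \<longleftrightarrow> Q \<subseteq> atoms q \<and> set (ans q) \<subseteq> B \<and>
     (\<forall>\<alpha>\<in>atoms q. terms \<alpha> \<inter> (avars Q - B) \<noteq> {} \<longrightarrow> \<alpha> \<in> Q)"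

lemma tw_atoms_iff:
  assumes "tw_hom T q \<rho> h t"
  shows "\<alpha> \<in> tw_atoms q t \<longleftrightarrow> \<alpha> \<in> atoms q \<and> terms \<alpha> \<inter> snd t \<noteq> {}"
  using assms by (cases t) (auto simp: tw_hom_def tw_atoms_def)

lemma tw_atoms_terms: "\<alpha> \<in> tw_atoms q t \<Longrightarrow> terms \<alpha> \<subseteq> fst t \<union> snd t"
  by (cases t) (auto simp: tw_atoms_def)

lemma tw_atoms_subset: "tw_atoms q t \<subseteq> atoms q"
  by (cases t) (auto simp: tw_atoms_def)

lemma tw_hom_facts:
  assumes "tw_hom T q \<rho> h t"
  shows "fst t \<subseteq> avars (tw_atoms q t)" "fst t \<inter> snd t = {}" "snd t \<noteq> {}"
    "snd t \<subseteq> ex_vars q" "fst t \<subseteq> cq_vars q" "v \<in> fst t \<Longrightarrow> h v = Cst 0"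
    "\<alpha> \<in> tw_atoms q t \<Longrightarrow> map_atom h \<alpha> \<in> gen_model T q \<rho>"
  using assms by (cases t; auto simp: tw_hom_def avars_def)+

lemma tw_atoms_nonempty:
  assumes "tw_hom T q \<rho> h t"
  shows "tw_atoms q t \<noteq> {}"
proof -
  obtain v where "v \<in> snd t" "v \<in> cq_vars q"
    using tw_hom_facts(3,4)[OF assms] by (auto simp: ex_vars_def)
  then show ?thesis
    using tw_atoms_iff[OF assms] by (fastforce simp: cq_vars_def)
qed

text \<open>Every root variable shares an atom with an interior variable, and that atom has no room for
  a second root variable.\<close>

lemma card_tw_roots:
  assumes "tw_hom T q \<rho> h t" and "finite (atoms q)"
  shows "card (fst t) \<le> card (tw_atoms q t)"
proof -
  have "\<exists>\<alpha>\<in>tw_atoms q t. terms \<alpha> \<inter> fst t = {v}" if v: "v \<in> fst t" for v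
  proof -
    obtain \<alpha> where \<alpha>: "\<alpha> \<in> tw_atoms q t" "v \<in> terms \<alpha>"
      using v tw_hom_facts(1)[OF assms(1)] by (auto simp: avars_def)
    then obtain w where w: "w \<in> terms \<alpha>" "w \<in> snd t"
      using tw_atoms_iff[OF assms(1)] by blast
    have "v \<noteq> w" using v w tw_hom_facts(2)[OF assms(1)] by auto
    then have "card {v, w} = 2" by simp
    then have "{v, w} = terms \<alpha>"
      using \<alpha> w card_terms_le_2[of \<alpha>] by (intro card_seteq) auto
    then have "terms \<alpha> \<inter> fst t = {v}"
      using v w tw_hom_facts(2)[OF assms(1)] by auto
    then show ?thesis using \<alpha>(1) by blast
  qed
  then obtain f where f: "\<And>v. v \<in> fst t \<Longrightarrow> f v \<in> tw_atoms q t \<and> terms (f v) \<inter> fst t = {v}"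
    by metis
  have "inj_on f (fst t)" by (rule inj_onI) (metis f singleton_inject)
  moreover have "finite (tw_atoms q t)"
    using assms(2) tw_atoms_subset finite_subset by blast
  ultimately show ?thesis using f by (intro card_inj_on_le[of f]) auto
qed

locale omq =
  fixes T :: "tgd set" and q :: cq
  assumes ont: "ontology T" and cq: "is_cq q"
begin

lemma finite_atoms: "finite (atoms q)"
  using cq by (simp add: is_cq_def)

lemma finite_cq_vars: "finite (cq_vars q)"
  using finite_atoms by (simp add: cq_vars_def)

lemma fresh_name_notin:
  assumes "\<alpha> \<in> ontology_atoms T \<union> atoms q"
  shows "fresh_name T q \<notin> un_names \<alpha>"
proof -
  have "finite (\<Union>\<alpha>\<in>ontology_atoms T \<union> atoms q. un_names \<alpha>)"
    using ont finite_atoms by (auto simp: ontology_def ontology_atoms_def)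
  then have "\<exists>S. S \<notin> (\<Union>\<alpha>\<in>ontology_atoms T \<union> atoms q. un_names \<alpha>)"
    by (rule ex_new_if_finite[OF infinite_UNIV_nat])
  then have "fresh_name T q \<notin> (\<Union>\<alpha>\<in>ontology_atoms T \<union> atoms q. un_names \<alpha>)"
    unfolding fresh_name_def by (rule LeastI_ex)
  then show ?thesis using assms by blast
qed

text \<open>A generator taken from a body has no existential variable, so the fresh tgd merely adds
  the generator atom at the root, without a null.\<close>

lemma canonical_subset_gen_model:
  assumes "\<rho> \<in> body_gen ` T"
  shows "canonical T {gen_atom \<rho>} \<subseteq> gen_model T q \<rho>"
proof
  obtain \<tau>0 where \<tau>0: "gen_atom \<rho> = map_atom (\<lambda>_. 0) (body \<tau>0)"
    using assms gen_atom_body_gen by blast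
  let ?fr = "Unary (fresh_name T q) 0 :: nat atom"
  have "map_atom Cst ?fr \<in> gen_model T q \<rho>"
    unfolding gen_model_def by (intro canonical.data) simp
  then have "map_atom (\<lambda>v. if v \<in> terms (body (TGD ?fr [gen_atom \<rho>])) then Cst v
      else Null (TGD ?fr [gen_atom \<rho>]) (map_atom Cst ?fr) v) (gen_atom \<rho>) \<in> gen_model T q \<rho>"
    unfolding gen_model_def by (intro canonical.fire[where \<sigma> = Cst]) simp_all
  also have "map_atom (\<lambda>v. if v \<in> terms (body (TGD ?fr [gen_atom \<rho>])) then Cst v
      else Null (TGD ?fr [gen_atom \<rho>]) (map_atom Cst ?fr) v) (gen_atom \<rho>) =
      map_atom Cst (gen_atom \<rho>)"
    unfolding \<tau>0 by (intro atom.map_cong0) (auto simp: atom.set_map)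
  finally have base: "map_atom Cst (gen_atom \<rho>) \<in> gen_model T q \<rho>" .
  fix \<alpha> assume "\<alpha> \<in> canonical T {gen_atom \<rho>}"
  then show "\<alpha> \<in> gen_model T q \<rho>"
  proof induction
    case (data \<alpha>)
    then show ?case using base by simp
  next
    case (fire \<tau> \<beta> \<sigma> \<psi>)
    then show ?case
      unfolding gen_model_def by (intro canonical.fire[where \<sigma> = \<sigma>]) simp_all
  qed
qed

text \<open>The fresh predicate occurs in no tgd of \<open>T\<close>, so the start atom can trigger
  only the fresh tgd.\<close>

lemma gen_model_subset_canonical:
  assumes "\<rho> \<in> body_gen ` T"
  shows "gen_model T q \<rho> \<subseteq> insert (Unary (fresh_name T q) (Cst 0)) (canonical T {gen_atom \<rho>})"
proof
  obtain \<tau>0 where \<tau>0: "\<tau>0 \<in> T" "gen_atom \<rho> = map_atom (\<lambda>_. 0) (body \<tau>0)"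
    using assms gen_atom_body_gen by blast
  have fr: "fresh_name T q \<notin> un_names \<beta>" if "\<beta> \<in> canonical T {gen_atom \<rho>}" for \<beta>
  proof -
    have "body \<tau>0 \<in> ontology_atoms T" using \<tau>0(1) by (auto simp: ontology_atoms_def)
    then show ?thesis
      using canonical_un_names[OF that] \<tau>0(2) fresh_name_notin by auto
  qed
  fix \<alpha> assume "\<alpha> \<in> gen_model T q \<rho>"
  then show "\<alpha> \<in> insert (Unary (fresh_name T q) (Cst 0)) (canonical T {gen_atom \<rho>})"
    unfolding gen_model_def
  proof induction
    case (data \<alpha>)
    then show ?case by simp
  next
    case (fire \<tau> \<beta> \<sigma> \<psi>)
    show ?case
    proof (cases "\<tau> \<in> T")
      case True
      then have "body \<tau> \<in> ontology_atoms T" by (auto simp: ontology_atoms_def)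
      then have "fresh_name T q \<notin> un_names \<beta>"
        using fresh_name_notin fire.hyps(2) by auto
      then have "\<beta> \<in> canonical T {gen_atom \<rho>}" using fire.IH by auto
      then show ?thesis
        using fire.hyps True by (intro insertI2 canonical.fire[where \<sigma> = \<sigma>]) simp_all
    next
      case False
      then have \<tau>: "\<tau> = TGD (Unary (fresh_name T q) 0) [gen_atom \<rho>]" using fire.hyps(1) by simp
      then have \<beta>: "\<beta> = Unary (fresh_name T q) (\<sigma> 0)" using fire.hyps(2) by simp
      then have "\<sigma> 0 = Cst 0" using fire.IH fr[of \<beta>] by auto
      then have "map_atom (\<lambda>v. if v \<in> terms (body \<tau>) then \<sigma> v else Null \<tau> \<beta> v) \<psi> =
          map_atom Cst (gen_atom \<rho>)"
        using \<tau> fire.hyps(4) \<tau>0(2) by (auto intro!: atom.map_cong0 simp: atom.set_map)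
      then show ?thesis by (metis canonical.data insertCI)
    qed
  qed
qed

text \<open>Soundness of a tree witness: wherever the generator atom holds in the data, the tree of
  the generator is copied below that constant, and the homomorphism of the witness follows by
  renaming.\<close>

lemma tw_hom_into_canonical:
  assumes "\<rho> \<in> body_gen ` T" and "tw_hom T q \<rho> h t" and "map_atom (\<lambda>_. c) (gen_atom \<rho>) \<in> A"
    and "\<alpha> \<in> tw_atoms q t"
  shows "map_atom (rename (\<lambda>_. c) \<circ> h) \<alpha> \<in> canonical T A"
proof -
  have "map_atom h \<alpha> \<in> gen_model T q \<rho>"
    using tw_hom_facts(7)[OF assms(2,4)] .
  moreover have "map_atom h \<alpha> \<noteq> Unary (fresh_name T q) (Cst 0)"
  proof
    assume "map_atom h \<alpha> = Unary (fresh_name T q) (Cst 0)"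
    then have "un_names \<alpha> = {fresh_name T q}"
      by (metis un_names.simps(1) un_names_map_atom)
    moreover have "\<alpha> \<in> atoms q" using assms(4) tw_atoms_subset by blast
    ultimately show False using fresh_name_notin[of \<alpha>] by simp
  qed
  ultimately have "map_atom h \<alpha> \<in> canonical T {gen_atom \<rho>}"
    using gen_model_subset_canonical[OF assms(1)] by blast
  then have "map_atom (rename (\<lambda>_. c)) (map_atom h \<alpha>) \<in> canonical T (map_atom (\<lambda>_. c) ` {gen_atom \<rho>})"
    by (rule rename_canonical)
  moreover have "canonical T (map_atom (\<lambda>_. c) ` {gen_atom \<rho>}) \<subseteq> canonical T A"
    using assms(3) by (intro canonical_mono) auto
  ultimately show ?thesis by (auto simp: atom.map_comp)
qed

text \<open>Completeness: the connected piece of null-mapped variables around \<open>z\<close> is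
  the interior of a tree witness. It stays inside the subtree of one null, and its boundary can only
  be mapped to the constant at the root of that subtree.\<close>

lemma exists_tree_witness:
  assumes sub: "subquery q Q B" and "complete_data T A"
    and h: "\<And>\<alpha>. \<alpha> \<in> Q \<Longrightarrow> map_atom h \<alpha> \<in> canonical T A"
    and hB: "\<And>v. v \<in> B \<Longrightarrow> h v \<in> range Cst"
    and z: "z \<in> avars Q" "h z \<notin> range Cst"
  obtains \<rho> t c where "\<rho> \<in> body_gen ` T" "tree_witness_by T q \<rho> t" "z \<in> snd t"
    "snd t \<subseteq> avars Q - B" "map_atom (\<lambda>_. c) (gen_atom \<rho>) \<in> A"
    "\<And>v. v \<in> fst t \<Longrightarrow> h v = Cst c"
proof -
  obtain \<alpha>0 where \<alpha>0: "\<alpha>0 \<in> Q" "z \<in> terms \<alpha>0" using z(1) by (auto simp: avars_def)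
  have hz: "h z \<in> terms (map_atom h \<alpha>0)" "h z \<noteq> Cst c" for c
    using \<alpha>0(2) z(2) by (auto simp: atom.set_map)
  obtain \<tau> v c where \<tau>: "\<tau> \<in> T" "map_atom Cst (map_atom (\<lambda>_. c) (body \<tau>)) \<in> canonical T A"
    and N: "below (Null \<tau> (map_atom Cst (map_atom (\<lambda>_. c) (body \<tau>))) v) (h z)"
    by (rule canonical_null_root[OF ont h[OF \<alpha>0(1)] hz])
  let ?\<beta> = "map_atom (\<lambda>_. c) (body \<tau>)"
  define N where "N = Null \<tau> (map_atom Cst ?\<beta>) v"
  define \<rho> where "\<rho> = body_gen \<tau>"
  have term\<beta>: "terms ?\<beta> = {c}" by (simp add: atom.set_map image_constant_conv)
  have \<rho>: "\<rho> \<in> body_gen ` T" using \<tau>(1) by (simp add: \<rho>_def)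
  have gen\<rho>: "map_atom (\<lambda>_. c) (gen_atom \<rho>) = ?\<beta>"
    by (simp add: \<rho>_def gen_atom_body_gen atom.map_comp comp_def)
  have \<beta>A: "?\<beta> \<in> A" using \<tau>(2) canonical_ground_iff[OF assms(2)] by blast
  have below_not_Cst: "e \<notin> range Cst" if "below N e" for e
    using not_below_Cst that by (auto simp: N_def)

  \<comment> \<open>\<open>W\<close> collects the null-mapped variables, \<open>I\<close> is the
    piece of them connected to \<open>z\<close>, and \<open>R\<close> is its boundary in the
    query.\<close>
  define W where "W = {v \<in> avars Q. h v \<notin> range Cst}"
  define I where "I = component (gaifman q) W z"
  define R where "R = avars {\<alpha> \<in> atoms q. terms \<alpha> \<inter> I \<noteq> {}} - I"
  have zW: "z \<in> W" using z by (simp add: W_def)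
  have IW: "I \<subseteq> W" unfolding I_def using zW by (rule component_subset)
  have WB: "W \<subseteq> avars Q - B" using hB by (auto simp: W_def)
  have IQ: "\<alpha> \<in> Q" if "\<alpha> \<in> atoms q" "terms \<alpha> \<inter> I \<noteq> {}" for \<alpha>
    using sub that IW WB unfolding subquery_def by blast
  have below_nb: "map_atom h \<alpha> \<in> canonical T {?\<beta>} \<and> (\<forall>w\<in>terms \<alpha>. below N (h w) \<or> h w = Cst c)"
    if "\<alpha> \<in> Q" "u \<in> terms \<alpha>" "below N (h u)" for \<alpha> u
    using below_subtree[OF ont h[OF that(1)] _ that(3) N_def term\<beta>] that(2)
    by (auto simp: atom.set_map)
  \<comment> \<open>The only term next to the subtree of \<open>N\<close> is the constant
    \<open>c\<close>, so a connected set of null-mapped variables cannot leave the subtree.\<close>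
  have I_below: "below N (h u)" if "u \<in> I" for u
  proof -
    have "I \<subseteq> {u. below N (h u)}"
      unfolding I_def
    proof (rule component_least)
      fix x y assume *: "x \<in> {u. below N (h u)}" "x \<in> W" "y \<in> W" "(x, y) \<in> gaifman q"
      then obtain \<alpha> where \<alpha>: "\<alpha> \<in> atoms q" "x \<in> terms \<alpha>" "y \<in> terms \<alpha>"
        by (auto simp: gaifman_def)
      then have "\<alpha> \<in> Q" using sub WB *(2) unfolding subquery_def by blast
      then have "below N (h y) \<or> h y = Cst c" using below_nb \<alpha> * by blast
      then show "y \<in> {u. below N (h u)}" using *(3) by (auto simp: W_def)
    qed (use N N_def in simp)
    then show ?thesis using that by blast
  qed
  have hR: "h u = Cst c" if u: "u \<in> R" for u
  proof -
    obtain \<alpha> w where \<alpha>: "\<alpha> \<in> atoms q" "u \<in> terms \<alpha>" "w \<in> terms \<alpha>" "w \<in> I" "u \<notin> I"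
      using u unfolding R_def avars_def by blast
    have "\<alpha> \<in> Q" using IQ \<alpha> by blast
    then have "below N (h u) \<or> h u = Cst c" using below_nb I_below \<alpha> by blast
    moreover have "\<not> below N (h u)"
    proof
      assume "below N (h u)"
      then have "u \<in> W" using below_not_Cst \<open>\<alpha> \<in> Q\<close> \<alpha> by (auto simp: W_def avars_def)
      moreover have "(w, u) \<in> gaifman q" using \<alpha> by (auto simp: gaifman_def)
      moreover have "w \<in> W" using \<alpha>(4) IW by blast
      ultimately have "u \<in> I"
        using component_closed[of w "gaifman q" W z u] \<alpha>(4) by (simp add: I_def)
      then show False using \<alpha> by simp
    qed
    ultimately show ?thesis by simp
  qed
  have tw_atoms: "tw_atoms q (R, I) = {\<alpha> \<in> atoms q. terms \<alpha> \<inter> I \<noteq> {}}"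
    by (auto simp: tw_atoms_def R_def avars_def)
  \<comment> \<open>The generator model has root 0. Renaming every constant to 0 leaves nulls as
    nulls, so \<open>h'\<close> tells roots from interior exactly as \<open>h\<close> does.\<close>
  define h' where "h' = rename (\<lambda>_. 0) \<circ> h"
  have h'_Cst: "h' u = Cst 0 \<longleftrightarrow> h u \<in> range Cst" for u
    by (cases "h u") (auto simp: h'_def)
  have hom: "tw_hom T q \<rho> h' (R, I)"
    unfolding tw_hom_def prod.case
  proof (intro conjI)
    show "R \<subseteq> cq_vars q" by (auto simp: R_def avars_def cq_vars_def)
    show "R \<inter> I = {}" by (auto simp: R_def)
    show "I \<noteq> {}" using component_refl[of z] unfolding I_def by blast
    have "avars Q \<subseteq> cq_vars q" "set (ans q) \<subseteq> B"
      using sub by (auto simp: subquery_def avars_def cq_vars_def)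
    then show "I \<subseteq> ex_vars q"
      using IW WB unfolding ex_vars_def by blast
    show "\<forall>\<alpha>\<in>tw_atoms q (R, I). map_atom h' \<alpha> \<in> gen_model T q \<rho>"
    proof
      fix \<alpha> assume "\<alpha> \<in> tw_atoms q (R, I)"
      then have "map_atom h \<alpha> \<in> canonical T {?\<beta>}"
        using tw_atoms IQ I_below below_nb by blast
      then have "map_atom (rename (\<lambda>_. 0)) (map_atom h \<alpha>) \<in> canonical T (map_atom (\<lambda>_. 0) ` {?\<beta>})"
        by (rule rename_canonical)
      also have "map_atom (\<lambda>_. 0) ` {?\<beta>} = {gen_atom \<rho>}"
        by (simp add: \<rho>_def gen_atom_body_gen atom.map_comp comp_def)
      finally show "map_atom h' \<alpha> \<in> gen_model T q \<rho>"
        using canonical_subset_gen_model[OF \<rho>] by (auto simp: h'_def atom.map_comp)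
    qed
    define V where "V = (\<Union>\<alpha>\<in>tw_atoms q (R, I). terms \<alpha>)"
    have "h' u = Cst 0" if "u \<in> R" for u using hR[OF that] h'_Cst by blast
    moreover have "h' u \<noteq> Cst 0" if "u \<in> I" for u using IW that h'_Cst by (auto simp: W_def)
    moreover have "V \<subseteq> R \<union> I" by (auto simp: V_def tw_atoms_def)
    moreover have "R \<subseteq> V" unfolding V_def tw_atoms by (auto simp: R_def avars_def)
    ultimately show "R = {z \<in> (\<Union>\<alpha>\<in>tw_atoms q (R, I). terms \<alpha>). h' z = Cst 0}"
      unfolding V_def[symmetric] by blast
    show "\<forall>\<alpha>\<in>atoms q. terms \<alpha> \<inter> I \<noteq> {} \<longrightarrow> \<alpha> \<in> tw_atoms q (R, I)" by (auto simp: tw_atoms)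
  qed
  \<comment> \<open>Minimality: a witness for the same \<open>h'\<close> covers all atoms on its
    interior and can make no variable of \<open>I\<close> a root. Its interior therefore spreads
    along edges inside \<open>I\<close> and, once it meets the connected set \<open>I\<close>,
    contains all of it.\<close>
  have "\<not> tw_atoms q t' \<subset> tw_atoms q (R, I)" if t': "tw_hom T q \<rho> h' t'" for t'
  proof
    assume less: "tw_atoms q t' \<subset> tw_atoms q (R, I)"
    have nbr: "w \<in> snd t'" if "x \<in> snd t'" "\<alpha> \<in> atoms q" "x \<in> terms \<alpha>" "w \<in> terms \<alpha>" "w \<in> I"
      for x w \<alpha>
    proof -
      have "\<alpha> \<in> tw_atoms q t'" using tw_atoms_iff[OF t'] that by blast
      then have "w \<in> fst t' \<union> snd t'" using tw_atoms_terms that by blast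
      moreover have "h' w \<noteq> Cst 0" using IW that(5) h'_Cst by (auto simp: W_def)
      ultimately show ?thesis using tw_hom_facts(6)[OF t'] by auto
    qed
    obtain \<alpha> where \<alpha>: "\<alpha> \<in> tw_atoms q t'" using tw_atoms_nonempty[OF t'] by blast
    then obtain y where y: "y \<in> snd t'" "y \<in> terms \<alpha>" using tw_atoms_iff[OF t'] by blast
    obtain w where w: "w \<in> terms \<alpha>" "w \<in> I" using \<alpha> less tw_atoms by blast
    have "w \<in> snd t'" using nbr[OF y(1) _ y(2) w] \<alpha> tw_atoms_subset by blast
    have symg: "sym (gaifman q)" by (auto simp: sym_def gaifman_def)
    have "I \<subseteq> snd t'"
    proof
      fix u assume u: "u \<in> I"
      let ?G = "gaifman q \<inter> W \<times> W"
      have symG: "sym (?G\<^sup>*)" using symg by (intro sym_rtrancl) (auto simp: sym_def)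
      have "(w, z) \<in> ?G\<^sup>*" "(z, u) \<in> ?G\<^sup>*"
        using w u symD[OF symG] by (auto simp: I_def component_def)
      then have "(w, u) \<in> ?G\<^sup>*" by (rule rtrancl_trans)
      then have "u \<in> snd t' \<and> u \<in> I"
      proof induction
        case base
        then show ?case using \<open>w \<in> snd t'\<close> w by simp
      next
        case (step x y)
        then have "y \<in> I"
          using component_closed[of x "gaifman q" W z y] by (simp add: I_def)
        moreover obtain \<alpha> where "\<alpha> \<in> atoms q" "x \<in> terms \<alpha>" "y \<in> terms \<alpha>"
          using step by (auto simp: gaifman_def)
        ultimately show ?case using step.IH nbr by blast
      qed
      then show "u \<in> snd t'" ..
    qed
    then have "tw_atoms q (R, I) \<subseteq> tw_atoms q t'" using tw_atoms tw_atoms_iff[OF t'] by blast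
    then show False using less by blast
  qed
  then have "tree_witness_by T q \<rho> (R, I)" using hom by (auto simp: tree_witness_by_def)
  moreover have "z \<in> I" by (simp add: I_def)
  ultimately show thesis
    using that[of \<rho> "(R, I)" c] \<rho> IW WB gen\<rho> \<beta>A hR by auto
qed

end

subsection \<open>Rewriting subqueries\<close>

definition hom_ext :: "tgd set \<Rightarrow> const atom set \<Rightarrow> (var \<Rightarrow> const) \<Rightarrow> var atom set \<Rightarrow> var set \<Rightarrow> bool"
  where "hom_ext T A \<sigma> Q B \<longleftrightarrow>
    (\<exists>h. (\<forall>v\<in>B. h v = Cst (\<sigma> v)) \<and> (\<forall>\<alpha>\<in>Q. map_atom h \<alpha> \<in> canonical T A))"

definition rewritten_by :: "tgd set \<Rightarrow> var atom set \<Rightarrow> var set \<Rightarrow> pe \<Rightarrow> bool" where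
  "rewritten_by T Q B p \<longleftrightarrow> pe_fv p \<subseteq> B \<and>
    (\<forall>A \<sigma>. complete_data T A \<longrightarrow> (pe_sat (ind A) A \<sigma> p \<longleftrightarrow> hom_ext T A \<sigma> Q B))"

text \<open>There is no formula of size 0, so the empty conjunction needs separate treatment.\<close>

definition rewritable :: "tgd set \<Rightarrow> var atom set \<Rightarrow> var set \<Rightarrow> nat \<Rightarrow> bool" where
  "rewritable T Q B s \<longleftrightarrow> Q = {} \<or> (\<exists>p. rewritten_by T Q B p \<and> pe_size p \<le> s)"

lemma hom_ext_cong: "(\<And>v. v \<in> B \<Longrightarrow> \<sigma> v = \<sigma>' v) \<Longrightarrow> hom_ext T A \<sigma> Q B = hom_ext T A \<sigma>' Q B"
  unfolding hom_ext_def by (metis (no_types, lifting))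

lemma hom_ext_empty: "hom_ext T A \<sigma> {} B"
  unfolding hom_ext_def by (intro exI[of _ "Cst \<circ> \<sigma>"]) simp

lemma rewritable_mono: "rewritable T Q B s \<Longrightarrow> s \<le> s' \<Longrightarrow> rewritable T Q B s'"
  unfolding rewritable_def by (meson order_trans)

text \<open>Shared variables are fixed, so two extensions agree on them and can be glued.\<close>

lemma hom_ext_Un:
  assumes "avars Q1 \<inter> avars Q2 \<subseteq> B"
  shows "hom_ext T A \<sigma> (Q1 \<union> Q2) B \<longleftrightarrow> hom_ext T A \<sigma> Q1 B \<and> hom_ext T A \<sigma> Q2 B"
proof
  assume "hom_ext T A \<sigma> Q1 B \<and> hom_ext T A \<sigma> Q2 B"
  then obtain h1 h2 where h: "\<forall>v\<in>B. h1 v = Cst (\<sigma> v)" "\<forall>\<alpha>\<in>Q1. map_atom h1 \<alpha> \<in> canonical T A"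
    "\<forall>v\<in>B. h2 v = Cst (\<sigma> v)" "\<forall>\<alpha>\<in>Q2. map_atom h2 \<alpha> \<in> canonical T A"
    unfolding hom_ext_def by blast
  define h where "h v = (if v \<in> avars Q1 then h1 v else h2 v)" for v
  have "map_atom h \<alpha> = map_atom h1 \<alpha>" if "\<alpha> \<in> Q1" for \<alpha>
    using that by (intro atom.map_cong0) (auto simp: h_def avars_def)
  moreover have "map_atom h \<alpha> = map_atom h2 \<alpha>" if "\<alpha> \<in> Q2" for \<alpha>
  proof (rule atom.map_cong0)
    fix v assume "v \<in> terms \<alpha>"
    then have "v \<in> avars Q2" using that by (auto simp: avars_def)
    then show "h v = h2 v" using assms h(1,3) by (auto simp: h_def)
  qed
  ultimately show "hom_ext T A \<sigma> (Q1 \<union> Q2) B"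
    using h unfolding hom_ext_def by (intro exI[of _ h]) (auto simp: h_def)
qed (auto simp: hom_ext_def)

lemma rewritable_Un:
  assumes "rewritable T Q1 B s1" and "rewritable T Q2 B s2" and "avars Q1 \<inter> avars Q2 \<subseteq> B"
  shows "rewritable T (Q1 \<union> Q2) B (s1 + s2)"
proof (cases "Q1 = {} \<or> Q2 = {}")
  case True
  then show ?thesis using assms rewritable_mono[of T _ B _ "s1 + s2"] by auto
next
  case False
  then obtain p1 p2 where "rewritten_by T Q1 B p1" "pe_size p1 \<le> s1"
    "rewritten_by T Q2 B p2" "pe_size p2 \<le> s2"
    using assms by (auto simp: rewritable_def)
  then have "rewritten_by T (Q1 \<union> Q2) B (And p1 p2)" "pe_size (And p1 p2) \<le> s1 + s2"
    by (auto simp: rewritten_by_def hom_ext_Un[OF assms(3)])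
  then show ?thesis by (auto simp: rewritable_def)
qed

lemma rewritable_ground_atom:
  assumes "terms \<alpha> \<subseteq> B"
  shows "rewritable T {\<alpha>} B 1"
proof -
  have "rewritten_by T {\<alpha>} B (Atom \<alpha>)"
    unfolding rewritten_by_def
  proof (intro conjI allI impI)
    fix A \<sigma> assume A: "complete_data T A"
    have "map_atom h \<alpha> = map_atom Cst (map_atom \<sigma> \<alpha>)" if "\<forall>v\<in>B. h v = Cst (\<sigma> v)" for h
      unfolding atom.map_comp using that assms by (intro atom.map_cong0) auto
    then have "hom_ext T A \<sigma> {\<alpha>} B \<longleftrightarrow> map_atom Cst (map_atom \<sigma> \<alpha>) \<in> canonical T A"
      unfolding hom_ext_def by (auto intro!: exI[of _ "Cst \<circ> \<sigma>"])
    then show "pe_sat (ind A) A \<sigma> (Atom \<alpha>) \<longleftrightarrow> hom_ext T A \<sigma> {\<alpha>} B"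
      using canonical_ground_iff[OF A] by simp
  qed (use assms in simp)
  then show ?thesis by (auto simp: rewritable_def)
qed

lemma rewritable_ground:
  assumes "finite Q" and "avars Q \<subseteq> B"
  shows "rewritable T Q B (card Q)"
  using assms
proof (induction Q)
  case empty
  then show ?case by (simp add: rewritable_def)
next
  case (insert \<alpha> Q)
  then have "rewritable T ({\<alpha>} \<union> Q) B (1 + card Q)"
    by (intro rewritable_Un rewritable_ground_atom) (auto simp: avars_def)
  then show ?case using insert by simp
qed

section \<open>Finite conjunctions, disjunctions and blocks of quantifiers\<close>

lemma conj_list:
  "pe_sat D F \<sigma> (foldr And ps p) \<longleftrightarrow> (\<forall>p'\<in>set ps. pe_sat D F \<sigma> p') \<and> pe_sat D F \<sigma> p"
  "pe_fv (foldr And ps p) = (\<Union>p'\<in>set ps. pe_fv p') \<union> pe_fv p"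
  "pe_size (foldr And ps p) = sum_list (map pe_size ps) + pe_size p"
  by (induction ps) auto

lemma disj_list:
  "pe_sat D F \<sigma> (foldr Or ps p) \<longleftrightarrow> (\<exists>p'\<in>set ps. pe_sat D F \<sigma> p') \<or> pe_sat D F \<sigma> p"
  "pe_fv (foldr Or ps p) = (\<Union>p'\<in>set ps. pe_fv p') \<union> pe_fv p"
  "pe_size (foldr Or ps p) = sum_list (map pe_size ps) + pe_size p"
  by (induction ps) auto

lemma disj_set:
  assumes "finite X"
  obtains p where "\<And>D (F :: const atom set) \<sigma>. pe_sat D F \<sigma> p \<longleftrightarrow> (\<exists>x\<in>X. pe_sat D F \<sigma> (f x)) \<or> pe_sat D F \<sigma> p0"
    "pe_fv p = (\<Union>x\<in>X. pe_fv (f x)) \<union> pe_fv p0"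
    "pe_size p = (\<Sum>x\<in>X. pe_size (f x)) + pe_size p0"
proof -
  obtain xs where xs: "set xs = X" "distinct xs" using finite_distinct_list[OF assms] by blast
  show thesis
    using that[of "foldr Or (map f xs) p0"] xs
    by (simp add: disj_list o_def sum_list_distinct_conv_sum_set)
qed

lemma disj_set_nonempty:
  assumes "finite X" and "X \<noteq> {}"
  obtains p where "\<And>D (F :: const atom set) \<sigma>. pe_sat D F \<sigma> p \<longleftrightarrow> (\<exists>x\<in>X. pe_sat D F \<sigma> (f x))"
    "pe_fv p = (\<Union>x\<in>X. pe_fv (f x))" "pe_size p = (\<Sum>x\<in>X. pe_size (f x))"
proof -
  obtain x0 where x0: "x0 \<in> X" using assms(2) by blast
  have X: "X = insert x0 (X - {x0})" using x0 by blast
  obtain p where p: "\<And>D (F :: const atom set) \<sigma>. pe_sat D F \<sigma> p \<longleftrightarrow>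
      (\<exists>x\<in>X - {x0}. pe_sat D F \<sigma> (f x)) \<or> pe_sat D F \<sigma> (f x0)"
    "pe_fv p = (\<Union>x\<in>X - {x0}. pe_fv (f x)) \<union> pe_fv (f x0)"
    "pe_size p = (\<Sum>x\<in>X - {x0}. pe_size (f x)) + pe_size (f x0)"
    using disj_set[of "X - {x0}" f "f x0"] assms(1) by auto
  show thesis
  proof (rule that)
    show "pe_sat D F \<sigma> p \<longleftrightarrow> (\<exists>x\<in>X. pe_sat D F \<sigma> (f x))" for D and F :: "const atom set" and \<sigma>
      unfolding p(1) using x0 by blast
    show "pe_fv p = (\<Union>x\<in>X. pe_fv (f x))" unfolding p(2) using x0 by blast
    show "pe_size p = (\<Sum>x\<in>X. pe_size (f x))"
      unfolding p(3) using sum.remove[OF assms(1) x0, of "\<lambda>x. pe_size (f x)"] by simp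
  qed
qed

lemma ex_list:
  "pe_sat D F \<sigma> (foldr Ex xs p) \<longleftrightarrow>
     (\<exists>\<sigma>'. (\<forall>v. v \<notin> set xs \<longrightarrow> \<sigma>' v = \<sigma> v) \<and> \<sigma>' ` set xs \<subseteq> D \<and> pe_sat D F \<sigma>' p)"
proof (induction xs arbitrary: \<sigma>)
  case Nil
  have "(\<forall>v. \<sigma>' v = \<sigma> v) \<longleftrightarrow> \<sigma>' = \<sigma>" for \<sigma>' by auto
  then show ?case by simp
next
  case (Cons x xs)
  show ?case
  proof
    assume "pe_sat D F \<sigma> (foldr Ex (x # xs) p)"
    then obtain d \<sigma>' where d: "d \<in> D" "\<forall>v. v \<notin> set xs \<longrightarrow> \<sigma>' v = (\<sigma>(x := d)) v"
      "\<sigma>' ` set xs \<subseteq> D" "pe_sat D F \<sigma>' p"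
      using Cons.IH by auto
    have "\<sigma>' x \<in> D" using d(1-3) by (cases "x \<in> set xs") auto
    then show "\<exists>\<sigma>'. (\<forall>v. v \<notin> set (x # xs) \<longrightarrow> \<sigma>' v = \<sigma> v) \<and> \<sigma>' ` set (x # xs) \<subseteq> D \<and>
        pe_sat D F \<sigma>' p"
      using d by (intro exI[of _ \<sigma>']) auto
  next
    assume "\<exists>\<sigma>'. (\<forall>v. v \<notin> set (x # xs) \<longrightarrow> \<sigma>' v = \<sigma> v) \<and> \<sigma>' ` set (x # xs) \<subseteq> D \<and>
        pe_sat D F \<sigma>' p"
    then obtain \<sigma>' where \<sigma>': "\<forall>v. v \<notin> set (x # xs) \<longrightarrow> \<sigma>' v = \<sigma> v" "\<sigma>' ` set (x # xs) \<subseteq> D"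
      "pe_sat D F \<sigma>' p" by blast
    then have "pe_sat D F (\<sigma>(x := \<sigma>' x)) (foldr Ex xs p)"
      unfolding Cons.IH by (intro exI[of _ \<sigma>']) auto
    then show "pe_sat D F \<sigma> (foldr Ex (x # xs) p)" using \<sigma>'(2) by auto
  qed
qed

lemma ex_list_fv_size:
  "pe_fv (foldr Ex xs p) = pe_fv p - set xs" "pe_size (foldr Ex xs p) = pe_size p"
  by (induction xs) auto

context omq
begin

text \<open>The disjunct for one tree witness: quantify the roots, equate them with one
  representative, require some generator there, and conjoin the formula for the uncovered atoms. All
  generators of the same witness share that last formula, so their number is added to its size and
  does not multiply it.\<close>

lemma tw_formula:
  fixes t :: "var set \<times> var set"
  assumes G_def: "G = {\<rho> \<in> body_gen ` T. tree_witness_by T q \<rho> t}"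
    and G: "G \<noteq> {}" and z: "z \<notin> B"
    and rest: "rewritable T Q' (B \<union> fst t) s"
  shows "\<exists>p. pe_fv p \<subseteq> B \<and> pe_size p \<le> card (tw_atoms q t) - 1 + card (body_gen ` T) + s \<and>
    (\<forall>A \<sigma>. complete_data T A \<longrightarrow> pe_sat (ind A) A \<sigma> p =
       (\<exists>\<rho>\<in>G. \<exists>\<sigma>' c. (\<forall>v\<in>B. \<sigma>' v = \<sigma> v) \<and> (\<forall>v\<in>fst t. \<sigma>' v = c) \<and>
          map_atom (\<lambda>_. c) (gen_atom \<rho>) \<in> A \<and> hom_ext T A \<sigma>' Q' (B \<union> fst t)))"
proof -
  have finT: "finite (body_gen ` T)" using ont by (simp add: ontology_def)
  then have finG: "finite G" by (simp add: G_def)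
  obtain \<rho>0 h0 where \<rho>0: "tw_hom T q \<rho>0 h0 t" using G by (auto simp: G_def tree_witness_by_def)
  have fin: "finite (fst t)"
    using tw_hom_facts(5)[OF \<rho>0] finite_cq_vars by (rule finite_subset)
  \<comment> \<open>The constant that carries the generator is named by a root. A witness without
    roots offers no such name; \<open>z\<close>, which is not fixed, is then quantified in its
    place.\<close>
  define r where "r = (if fst t = {} then z else SOME x. x \<in> fst t)"
  have r: "r \<in> insert z (fst t)" "r \<in> fst t \<or> fst t = {} \<and> r = z"
    unfolding r_def by (auto intro: some_in_eq[THEN iffD2])
  define X where "X = insert z (fst t) - B"
  have "finite X" using fin by (simp add: X_def)
  then obtain xs where xs: "set xs = X" using finite_list by blast
  obtain ys where ys: "set ys = fst t - {r}" "distinct ys"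
    using fin finite_distinct_list[of "fst t - {r}"] by auto
  let ?atom = "\<lambda>\<rho>. Atom (map_atom (\<lambda>_. r) (gen_atom \<rho>))"
  obtain g where g: "\<And>D (F :: const atom set) \<sigma>. pe_sat D F \<sigma> g \<longleftrightarrow> (\<exists>\<rho>\<in>G. pe_sat D F \<sigma> (?atom \<rho>))"
    "pe_fv g = (\<Union>\<rho>\<in>G. pe_fv (?atom \<rho>))" "pe_size g = (\<Sum>\<rho>\<in>G. pe_size (?atom \<rho>))"
    using disj_set_nonempty[OF finG G, of ?atom] by blast
  have g_size: "pe_size g \<le> card (body_gen ` T)"
    using card_mono[OF finT, of G] by (auto simp: g(3) G_def)
  have g_fv: "pe_fv g \<subseteq> {r}" by (auto simp: g(2) atom.set_map)
  \<comment> \<open>A list of at most one formula: it is empty when the witness covers all of the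
    subquery, where no formula of size 0 exists.\<close>
  obtain rs where rs: "\<And>A \<sigma>. complete_data T A \<Longrightarrow>
        (\<forall>p\<in>set rs. pe_sat (ind A) A \<sigma> p) \<longleftrightarrow> hom_ext T A \<sigma> Q' (B \<union> fst t)"
      "\<And>p. p \<in> set rs \<Longrightarrow> pe_fv p \<subseteq> B \<union> fst t" "sum_list (map pe_size rs) \<le> s"
  proof (cases "Q' = {}")
    case True
    then show thesis using that[of "[]"] by (simp add: hom_ext_empty)
  next
    case False
    then obtain p' where "rewritten_by T Q' (B \<union> fst t) p'" "pe_size p' \<le> s"
      using rest by (auto simp: rewritable_def)
    then show thesis using that[of "[p']"] by (auto simp: rewritten_by_def)
  qed
  define p where "p = foldr Ex xs (foldr And (map (\<lambda>x. Eq x r) ys @ rs) g)"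
  show ?thesis
  proof (intro exI[of _ p] conjI allI impI)
    show "pe_fv p \<subseteq> B"
      using g_fv rs(2) r(1) by (fastforce simp: p_def ex_list_fv_size conj_list xs ys X_def)
    have "length ys \<le> card (tw_atoms q t) - 1"
    proof -
      have "length ys = card (fst t - {r})" using ys by (metis distinct_card)
      also have "\<dots> \<le> card (fst t) - 1"
        using r(2) by (cases "fst t = {}") (auto simp: card_Diff_singleton)
      also have "\<dots> \<le> card (tw_atoms q t) - 1"
        using card_tw_roots[OF \<rho>0 finite_atoms] by simp
      finally show ?thesis .
    qed
    then show "pe_size p \<le> card (tw_atoms q t) - 1 + card (body_gen ` T) + s"
      using g_size rs(3)
      by (simp add: p_def ex_list_fv_size conj_list o_def sum_list_triv)
    fix A \<sigma> assume A: "complete_data T A"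
    have sat: "pe_sat (ind A) A \<sigma>' (foldr And (map (\<lambda>x. Eq x r) ys @ rs) g) \<longleftrightarrow>
        (\<forall>x\<in>fst t. \<sigma>' x = \<sigma>' r) \<and> hom_ext T A \<sigma>' Q' (B \<union> fst t) \<and>
        (\<exists>\<rho>\<in>G. map_atom (\<lambda>_. \<sigma>' r) (gen_atom \<rho>) \<in> A)" for \<sigma>'
      unfolding conj_list using rs(1)[OF A, of \<sigma>']
      by (auto simp: ball_Un ys(1) g(1) atom.map_comp comp_def)
    show "pe_sat (ind A) A \<sigma> p =
       (\<exists>\<rho>\<in>G. \<exists>\<sigma>' c. (\<forall>v\<in>B. \<sigma>' v = \<sigma> v) \<and> (\<forall>v\<in>fst t. \<sigma>' v = c) \<and>
          map_atom (\<lambda>_. c) (gen_atom \<rho>) \<in> A \<and> hom_ext T A \<sigma>' Q' (B \<union> fst t))" (is "_ = ?rhs")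
    proof
      assume "pe_sat (ind A) A \<sigma> p"
      then obtain \<sigma>' where "\<forall>v. v \<notin> X \<longrightarrow> \<sigma>' v = \<sigma> v"
        "pe_sat (ind A) A \<sigma>' (foldr And (map (\<lambda>x. Eq x r) ys @ rs) g)"
        unfolding p_def ex_list xs by blast
      then show ?rhs unfolding sat by (auto simp: X_def)
    next
      assume ?rhs
      then obtain \<rho> \<sigma>' c where *: "\<rho> \<in> G" "\<forall>v\<in>B. \<sigma>' v = \<sigma> v" "\<forall>v\<in>fst t. \<sigma>' v = c"
        "map_atom (\<lambda>_. c) (gen_atom \<rho>) \<in> A" "hom_ext T A \<sigma>' Q' (B \<union> fst t)" by blast
      \<comment> \<open>The quantifiers reach only \<open>X\<close>, but \<open>\<sigma>'\<close>
        may differ from \<open>\<sigma>\<close> at any variable outside \<open>B\<close>. Changing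
        \<open>\<sigma>\<close> on \<open>X\<close> alone gives the same values on \<open>B\<close>
        and on the roots.\<close>
      define \<sigma>2 where "\<sigma>2 v = (if v \<in> X then c else \<sigma> v)" for v
      have t: "\<sigma>2 v = c" if "v \<in> fst t" for v
        using that *(2,3) by (auto simp: \<sigma>2_def X_def)
      have "\<sigma>2 z = c" using z by (simp add: \<sigma>2_def X_def)
      then have "\<sigma>2 r = c" using r(2) t[of r] by blast
      moreover have "hom_ext T A \<sigma>2 Q' (B \<union> fst t)"
      proof -
        have "hom_ext T A \<sigma>2 Q' (B \<union> fst t) = hom_ext T A \<sigma>' Q' (B \<union> fst t)"
          using t *(2,3) by (intro hom_ext_cong) (auto simp: \<sigma>2_def X_def)
        then show ?thesis using *(5) by simp
      qed
      ultimately have "pe_sat (ind A) A \<sigma>2 (foldr And (map (\<lambda>x. Eq x r) ys @ rs) g)"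
        unfolding sat using t *(1,4) by auto
      moreover have "c \<in> ind A"
      proof -
        have "c \<in> terms (map_atom (\<lambda>_. c) (gen_atom \<rho>))"
          using terms_nonempty[of "gen_atom \<rho>"] by (auto simp: atom.set_map simp del: terms_nonempty)
        then show ?thesis using *(4) by (auto simp: ind_def)
      qed
      then have "\<sigma>2 ` X \<subseteq> ind A" by (auto simp: \<sigma>2_def)
      ultimately show "pe_sat (ind A) A \<sigma> p"
        unfolding p_def ex_list xs by (intro exI[of _ \<sigma>2]) (auto simp: \<sigma>2_def)
    qed
  qed
qed

definition tws :: "var set \<Rightarrow> var \<Rightarrow> (var set \<times> var set) set" where
  "tws U z = {t. (\<exists>\<rho>\<in>body_gen ` T. tree_witness_by T q \<rho> t) \<and> z \<in> snd t \<and> snd t \<subseteq> U}"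

lemma tree_witnesses_subset: "tree_witnesses T q \<subseteq> Pow (cq_vars q) \<times> Pow (ex_vars q)"
proof
  fix t assume "t \<in> tree_witnesses T q"
  then obtain \<rho> h where "tw_hom T q \<rho> h t" by (auto simp: tree_witnesses_def tree_witness_by_def)
  then show "t \<in> Pow (cq_vars q) \<times> Pow (ex_vars q)"
    using tw_hom_facts(4,5) by (cases t) fastforce
qed

lemma finite_tree_witnesses: "finite (tree_witnesses T q)"
  using finite_cq_vars by (intro finite_subset[OF tree_witnesses_subset]) (auto simp: ex_vars_def)

lemma tws_subset: "tws U z \<subseteq> {t \<in> tree_witnesses T q. z \<in> snd t}"
  using body_gens_subset by (auto simp: tws_def tree_witnesses_def)

lemma finite_tws: "finite (tws U z)"
  using finite_tree_witnesses by (intro finite_subset[OF tws_subset]) auto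

text \<open>The summand 1 in the degree makes this strict, which leaves one of the d disjuncts for
  mapping \<open>z\<close> to a constant.\<close>

lemma card_tws:
  assumes "z \<in> ex_vars q"
  shows "card (tws U z) < tw_degree T q"
proof -
  have "card (tws U z) \<le> card {t \<in> tree_witnesses T q. z \<in> snd t}"
    using tws_subset finite_tree_witnesses by (intro card_mono) auto
  also have "\<dots> \<le> Max (insert 0 ((\<lambda>z. card {t \<in> tree_witnesses T q. z \<in> snd t}) ` ex_vars q))"
    using assms finite_cq_vars by (intro Max_ge) (auto simp: ex_vars_def)
  finally show ?thesis by (simp add: tw_degree_def)
qed

text \<open>A homomorphism sends \<open>z\<close> to a constant or to a null, and a null yields a
  tree witness. Conversely, the interior is mapped by the homomorphism of the witness, moved to the
  root \<open>c\<close>, and all other variables keep their values; the two parts meet only in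
  roots, which both map to \<open>c\<close>.\<close>

lemma hom_ext_split:
  assumes sub: "subquery q Q B" and z: "z \<in> avars Q - B" and A: "complete_data T A"
  shows "hom_ext T A \<sigma> Q B \<longleftrightarrow>
    (\<exists>c\<in>ind A. hom_ext T A (\<sigma>(z := c)) Q (insert z B)) \<or>
    (\<exists>t\<in>tws (avars Q - B) z. \<exists>\<rho>\<in>{\<rho> \<in> body_gen ` T. tree_witness_by T q \<rho> t}. \<exists>\<sigma>' c.
       (\<forall>v\<in>B. \<sigma>' v = \<sigma> v) \<and> (\<forall>v\<in>fst t. \<sigma>' v = c) \<and> map_atom (\<lambda>_. c) (gen_atom \<rho>) \<in> A \<and>
       hom_ext T A \<sigma>' (Q - tw_atoms q t) (B \<union> fst t))" (is "_ \<longleftrightarrow> ?cst \<or> ?null")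
proof
  assume "hom_ext T A \<sigma> Q B"
  then obtain h where h: "\<forall>v\<in>B. h v = Cst (\<sigma> v)" "\<forall>\<alpha>\<in>Q. map_atom h \<alpha> \<in> canonical T A"
    unfolding hom_ext_def by blast
  show "?cst \<or> ?null"
  proof (cases "h z \<in> range Cst")
    case True
    then obtain c where c: "h z = Cst c" by blast
    obtain \<alpha> where \<alpha>: "\<alpha> \<in> Q" "z \<in> terms \<alpha>" using z by (auto simp: avars_def)
    then have "Cst c \<in> terms (map_atom h \<alpha>)" using c by (force simp: atom.set_map)
    then have "c \<in> ind A" using canonical_Cst_ind h(2) \<alpha> by blast
    moreover have "hom_ext T A (\<sigma>(z := c)) Q (insert z B)"
      unfolding hom_ext_def using h c z by (intro exI[of _ h]) auto
    ultimately show ?thesis by blast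
  next
    case False
    obtain \<rho> t c where t: "\<rho> \<in> body_gen ` T" "tree_witness_by T q \<rho> t" "z \<in> snd t"
      "snd t \<subseteq> avars Q - B" "map_atom (\<lambda>_. c) (gen_atom \<rho>) \<in> A"
      "\<And>v. v \<in> fst t \<Longrightarrow> h v = Cst c"
      by (rule exists_tree_witness[OF sub A, of h z]) (use h z False in auto)
    define \<sigma>' where "\<sigma>' v = (if v \<in> fst t then c else \<sigma> v)" for v
    have "\<forall>v\<in>B. \<sigma>' v = \<sigma> v" using t(6) h(1) by (auto simp: \<sigma>'_def)
    moreover have "\<forall>v\<in>fst t. \<sigma>' v = c" by (simp add: \<sigma>'_def)
    moreover have "hom_ext T A \<sigma>' (Q - tw_atoms q t) (B \<union> fst t)"
      unfolding hom_ext_def using h t(6) by (intro exI[of _ h]) (auto simp: \<sigma>'_def)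
    moreover have "t \<in> tws (avars Q - B) z" using t by (auto simp: tws_def)
    ultimately show ?thesis using t(1,2,5) by blast
  qed
next
  assume "?cst \<or> ?null"
  then show "hom_ext T A \<sigma> Q B"
  proof
    assume ?cst
    then obtain c h where "\<forall>v\<in>insert z B. h v = Cst ((\<sigma>(z := c)) v)"
      "\<forall>\<alpha>\<in>Q. map_atom h \<alpha> \<in> canonical T A"
      unfolding hom_ext_def by blast
    then show ?thesis unfolding hom_ext_def using z by (intro exI[of _ h]) auto
  next
    assume ?null
    then obtain t \<rho> \<sigma>' c where *: "t \<in> tws (avars Q - B) z" "\<rho> \<in> body_gen ` T"
      "tree_witness_by T q \<rho> t" "\<forall>v\<in>B. \<sigma>' v = \<sigma> v" "\<forall>v\<in>fst t. \<sigma>' v = c"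
      "map_atom (\<lambda>_. c) (gen_atom \<rho>) \<in> A" "hom_ext T A \<sigma>' (Q - tw_atoms q t) (B \<union> fst t)"
      by blast
    obtain h1 where h1: "tw_hom T q \<rho> h1 t" using *(3) by (auto simp: tree_witness_by_def)
    obtain h2 where h2: "\<forall>v\<in>B \<union> fst t. h2 v = Cst (\<sigma>' v)"
      "\<forall>\<alpha>\<in>Q - tw_atoms q t. map_atom h2 \<alpha> \<in> canonical T A"
      using *(7) unfolding hom_ext_def by blast
    define h where "h v = (if v \<in> snd t then rename (\<lambda>_. c) (h1 v) else h2 v)" for v
    have "map_atom h \<alpha> \<in> canonical T A" if "\<alpha> \<in> Q" for \<alpha>
    proof (cases "\<alpha> \<in> tw_atoms q t")
      case True
      have "map_atom h \<alpha> = map_atom (rename (\<lambda>_. c) \<circ> h1) \<alpha>"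
      proof (rule atom.map_cong0)
        fix v assume "v \<in> terms \<alpha>"
        then consider "v \<in> snd t" | "v \<in> fst t" "v \<notin> snd t" using tw_atoms_terms True by blast
        then show "h v = (rename (\<lambda>_. c) \<circ> h1) v"
          using h2(1) *(5) tw_hom_facts(6)[OF h1] by cases (auto simp: h_def)
      qed
      then show ?thesis using tw_hom_into_canonical[OF *(2) h1 *(6) True] by simp
    next
      case False
      then have "terms \<alpha> \<inter> snd t = {}"
        using tw_atoms_iff[OF h1] that sub by (auto simp: subquery_def)
      then have "map_atom h \<alpha> = map_atom h2 \<alpha>" by (intro atom.map_cong0) (auto simp: h_def)
      then show ?thesis using h2(2) that False by simp
    qed
    moreover have "\<forall>v\<in>B. h v = Cst (\<sigma> v)"
      using h2(1) *(1,4) by (auto simp: h_def tws_def)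
    ultimately show ?thesis unfolding hom_ext_def by blast
  qed
qed

lemma rewritable_split:
  assumes sub: "subquery q Q B" and z: "z \<in> avars Q - B"
    and cst: "rewritable T Q (insert z B) s0"
    and null: "\<And>t. t \<in> tws (avars Q - B) z \<Longrightarrow>
      rewritable T (Q - tw_atoms q t) (B \<union> fst t) (s t)"
  shows "rewritable T Q B
    (s0 + (\<Sum>t\<in>tws (avars Q - B) z. card (tw_atoms q t) - 1 + card (body_gen ` T) + s t))"
proof -
  \<comment> \<open>The disjunction is built on the formula for the constant case, which exists
    because \<open>Q\<close> contains an atom on \<open>z\<close>.\<close>
  have "Q \<noteq> {}" using z by (auto simp: avars_def)
  then obtain p0 where p0: "rewritten_by T Q (insert z B) p0" "pe_size p0 \<le> s0"
    using cst by (auto simp: rewritable_def)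
  let ?W = "tws (avars Q - B) z"
  define sem where "sem A \<sigma> t \<longleftrightarrow> (\<exists>\<rho>\<in>{\<rho> \<in> body_gen ` T. tree_witness_by T q \<rho> t}. \<exists>\<sigma>' c.
       (\<forall>v\<in>B. \<sigma>' v = \<sigma> v) \<and> (\<forall>v\<in>fst t. \<sigma>' v = c) \<and> map_atom (\<lambda>_. c) (gen_atom \<rho>) \<in> A \<and>
       hom_ext T A \<sigma>' (Q - tw_atoms q t) (B \<union> fst t))" for A \<sigma> t
  have "\<exists>p. pe_fv p \<subseteq> B \<and> pe_size p \<le> card (tw_atoms q t) - 1 + card (body_gen ` T) + s t \<and>
      (\<forall>A \<sigma>. complete_data T A \<longrightarrow> pe_sat (ind A) A \<sigma> p = sem A \<sigma> t)" if t: "t \<in> ?W" for t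
  proof -
    have "{\<rho> \<in> body_gen ` T. tree_witness_by T q \<rho> t} \<noteq> {}" using t by (auto simp: tws_def)
    moreover have "z \<notin> B" using z by simp
    ultimately show ?thesis unfolding sem_def by (rule tw_formula[OF refl _ _ null[OF t]])
  qed
  then have "\<forall>t\<in>?W. \<exists>p. pe_fv p \<subseteq> B \<and>
      pe_size p \<le> card (tw_atoms q t) - 1 + card (body_gen ` T) + s t \<and>
      (\<forall>A \<sigma>. complete_data T A \<longrightarrow> pe_sat (ind A) A \<sigma> p = sem A \<sigma> t)" by (rule ballI)
  from bchoice[OF this] obtain f where f: "\<And>t. t \<in> ?W \<Longrightarrow> pe_fv (f t) \<subseteq> B"
    "\<And>t. t \<in> ?W \<Longrightarrow> pe_size (f t) \<le> card (tw_atoms q t) - 1 + card (body_gen ` T) + s t"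
    "\<And>t A \<sigma>. t \<in> ?W \<Longrightarrow> complete_data T A \<Longrightarrow> pe_sat (ind A) A \<sigma> (f t) = sem A \<sigma> t"
    by blast
  obtain p where p: "\<And>D (F :: const atom set) \<sigma>. pe_sat D F \<sigma> p \<longleftrightarrow>
      (\<exists>t\<in>?W. pe_sat D F \<sigma> (f t)) \<or> pe_sat D F \<sigma> (Ex z p0)"
    "pe_fv p = (\<Union>t\<in>?W. pe_fv (f t)) \<union> pe_fv (Ex z p0)"
    "pe_size p = (\<Sum>t\<in>?W. pe_size (f t)) + pe_size (Ex z p0)"
    using disj_set[OF finite_tws] by blast
  have "rewritten_by T Q B p"
    unfolding rewritten_by_def
  proof (intro conjI allI impI)
    show "pe_fv p \<subseteq> B" using f(1) p0(1) by (auto simp: p(2) rewritten_by_def)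
    fix A \<sigma> assume A: "complete_data T A"
    have eq1: "pe_sat (ind A) A \<sigma> (Ex z p0) \<longleftrightarrow> (\<exists>c\<in>ind A. hom_ext T A (\<sigma>(z := c)) Q (insert z B))"
      using p0(1) A by (simp add: rewritten_by_def)
    have eq2: "(\<exists>t\<in>?W. pe_sat (ind A) A \<sigma> (f t)) \<longleftrightarrow> (\<exists>t\<in>?W. sem A \<sigma> t)"
      by (intro bex_cong refl f(3) A)
    show "pe_sat (ind A) A \<sigma> p \<longleftrightarrow> hom_ext T A \<sigma> Q B"
      unfolding hom_ext_split[OF sub z A] p(1) eq1 eq2 sem_def by (rule disj_commute)
  qed
  moreover have "pe_size p \<le> s0 +
      (\<Sum>t\<in>?W. card (tw_atoms q t) - 1 + card (body_gen ` T) + s t)"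
    using p0(2) sum_mono[of ?W "\<lambda>t. pe_size (f t)", OF f(2)] by (simp add: p(3))
  ultimately show ?thesis by (auto simp: rewritable_def)
qed

end

subsection \<open>Divide and conquer along the tree\<close>

lemma sym_gaifman: "sym (gaifman q)"
  by (auto simp: sym_def gaifman_def)

lemma gaifman_subset: "gaifman q \<subseteq> cq_vars q \<times> cq_vars q"
  by (auto simp: gaifman_def cq_vars_def)

lemma acyclic_gaifman:
  assumes "tree_shaped q"
  shows "acyclic_graph (gaifman q)"
  unfolding acyclic_graph_def
proof (intro notI, elim exE conjE)
  fix c :: "var list"
  assume c: "3 \<le> length c" "distinct c" "successively (\<lambda>u v. (u, v) \<in> gaifman q) c"
    "(last c, hd c) \<in> gaifman q"
  moreover have "set c \<subseteq> cq_vars q"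
    using successively_subset[OF c(3) gaifman_subset] c(1) by simp
  ultimately show False using assms unfolding tree_shaped_def is_tree_def by blast
qed

lemma subquery_extend: "subquery q Q B \<Longrightarrow> B \<subseteq> B' \<Longrightarrow> subquery q Q B'"
  unfolding subquery_def by blast

text \<open>A witness covers every atom on its interior, so interior variables vanish from the rest.
  Conversely, an atom on a variable that is neither root nor interior is not covered.\<close>

lemma subquery_tw:
  assumes sub: "subquery q Q B" and hom: "tw_hom T q \<rho> h t"
  shows "subquery q (Q - tw_atoms q t) (B \<union> fst t)"
    and "avars (Q - tw_atoms q t) - (B \<union> fst t) \<subseteq> avars Q - B - fst t - snd t"
proof -
  have disj: "avars (Q - tw_atoms q t) \<inter> snd t = {}"
    using sub tw_atoms_iff[OF hom] unfolding subquery_def avars_def by blast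
  then show *: "avars (Q - tw_atoms q t) - (B \<union> fst t) \<subseteq> avars Q - B - fst t - snd t"
    by (auto simp: avars_def)
  show "subquery q (Q - tw_atoms q t) (B \<union> fst t)"
    unfolding subquery_def
  proof (intro conjI ballI impI)
    fix \<alpha> assume \<alpha>: "\<alpha> \<in> atoms q"
      "terms \<alpha> \<inter> (avars (Q - tw_atoms q t) - (B \<union> fst t)) \<noteq> {}"
    then obtain u where u: "u \<in> terms \<alpha>" "u \<in> avars (Q - tw_atoms q t) - (B \<union> fst t)" by blast
    then have u': "u \<in> avars Q - B" "u \<notin> fst t \<union> snd t" using * by blast+
    then have "\<alpha> \<in> Q" using sub \<alpha>(1) u(1) unfolding subquery_def by blast
    moreover have "\<alpha> \<notin> tw_atoms q t" using tw_atoms_terms u(1) u'(2) by blast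
    ultimately show "\<alpha> \<in> Q - tw_atoms q t" by blast
  qed (use sub in \<open>auto simp: subquery_def\<close>)
qed

text \<open>Open variables of one atom lie in one component, so the atoms that touch
  \<open>C\<close> share only fixed variables with the others. Atoms without open variables stay in
  the remainder.\<close>

lemma subquery_component:
  fixes Q B u q
  defines "C \<equiv> component (gaifman q) (avars Q - B) u"
  defines "Q1 \<equiv> {\<alpha> \<in> Q. terms \<alpha> \<inter> C \<noteq> {}}"
  assumes sub: "subquery q Q B" and u: "u \<in> avars Q - B"
  shows "subquery q Q1 B" "avars Q1 - B = C"
    "subquery q (Q - Q1) B" "avars (Q - Q1) - B = avars Q - B - C"
    "avars Q1 \<inter> avars (Q - Q1) \<subseteq> B"
proof -
  have CU: "C \<subseteq> avars Q - B" unfolding C_def using u by (rule component_subset)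
  have closed: "y \<in> C" if "\<alpha> \<in> Q" "x \<in> terms \<alpha>" "x \<in> C" "y \<in> terms \<alpha>" "y \<notin> B" for x y \<alpha>
  proof (cases "x = y")
    case False
    have "\<alpha> \<in> atoms q" using sub that(1) by (auto simp: subquery_def)
    then have "(x, y) \<in> gaifman q" using False that by (auto simp: gaifman_def)
    moreover have "x \<in> avars Q - B" "y \<in> avars Q - B"
      using that CU by (auto simp: avars_def)
    ultimately show ?thesis using that(3) unfolding C_def by (rule component_closed[rotated])
  qed (use that in simp)
  show 1: "avars Q1 - B = C"
  proof
    show "avars Q1 - B \<subseteq> C" using closed by (auto simp: Q1_def avars_def)
    show "C \<subseteq> avars Q1 - B"
    proof
      fix x assume x: "x \<in> C"
      then obtain \<alpha> where "\<alpha> \<in> Q" "x \<in> terms \<alpha>" "x \<notin> B" using CU by (auto simp: avars_def)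
      then show "x \<in> avars Q1 - B" using x by (auto simp: Q1_def avars_def)
    qed
  qed
  have notC: "x \<notin> C" if "x \<in> avars (Q - Q1)" for x
    using that by (auto simp: Q1_def avars_def)
  show 2: "avars (Q - Q1) - B = avars Q - B - C"
  proof
    show "avars (Q - Q1) - B \<subseteq> avars Q - B - C" using notC by (auto simp: avars_def)
    show "avars Q - B - C \<subseteq> avars (Q - Q1) - B"
    proof
      fix x assume x: "x \<in> avars Q - B - C"
      then obtain \<alpha> where \<alpha>: "\<alpha> \<in> Q" "x \<in> terms \<alpha>" by (auto simp: avars_def)
      have "\<alpha> \<notin> Q1" using \<alpha> x 1 by (auto simp: avars_def)
      then show "x \<in> avars (Q - Q1) - B" using \<alpha> x by (auto simp: avars_def)
    qed
  qed
  show "avars Q1 \<inter> avars (Q - Q1) \<subseteq> B" using 1 notC by blast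
  have inQ: "\<alpha> \<in> Q" if "\<alpha> \<in> atoms q" "x \<in> terms \<alpha>" "x \<in> avars Q - B" for \<alpha> x
    using sub that unfolding subquery_def by blast
  have Q: "Q \<subseteq> atoms q" "set (ans q) \<subseteq> B" using sub by (auto simp: subquery_def)
  show "subquery q Q1 B"
    unfolding subquery_def 1
  proof (intro conjI ballI impI)
    fix \<alpha> assume "\<alpha> \<in> atoms q" "terms \<alpha> \<inter> C \<noteq> {}"
    then show "\<alpha> \<in> Q1" using inQ CU by (auto simp: Q1_def)
  qed (use Q in \<open>auto simp: Q1_def\<close>)
  show "subquery q (Q - Q1) B"
    unfolding subquery_def 2
  proof (intro conjI ballI impI)
    fix \<alpha> assume \<alpha>: "\<alpha> \<in> atoms q" "terms \<alpha> \<inter> (avars Q - B - C) \<noteq> {}"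
    then obtain x where x: "x \<in> terms \<alpha>" "x \<in> avars Q - B" "x \<notin> C" by blast
    have "\<alpha> \<in> Q" using inQ \<alpha>(1) x by blast
    moreover have "\<alpha> \<notin> Q1" using x 1 by (auto simp: avars_def)
    ultimately show "\<alpha> \<in> Q - Q1" by blast
  qed (use Q in auto)
qed

text \<open>A bound proportional to the number of atoms adds up without loss over components, so it
  is enough that each component is small. Peeling off one component does not enlarge the
  others.\<close>

lemma rewritable_components:
  assumes fin: "finite (atoms q)"
    and small: "\<And>Q B. subquery q Q B \<Longrightarrow> card (avars Q - B) < m \<Longrightarrow> rewritable T Q B (k * card Q)"
    and "0 < m" and "subquery q Q B"
    and "\<And>u. u \<in> avars Q - B \<Longrightarrow> card (component (gaifman q) (avars Q - B) u) < m"
  shows "rewritable T Q B (k * card Q)"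
  using assms(4,5)
proof (induction "card Q" arbitrary: Q rule: less_induct)
  case less
  show ?case
  proof (cases "avars Q - B = {}")
    case True
    have "card (avars Q - B) < m" unfolding True using assms(3) by simp
    then show ?thesis by (rule small[OF less.prems(1)])
  next
    case False
    then obtain u where u: "u \<in> avars Q - B" by blast
    let ?C = "component (gaifman q) (avars Q - B) u"
    let ?Q1 = "{\<alpha> \<in> Q. terms \<alpha> \<inter> ?C \<noteq> {}}"
    note c = subquery_component[OF less.prems(1) u]
    have finQ: "finite Q" using fin less.prems(1) finite_subset by (auto simp: subquery_def)
    have "rewritable T ?Q1 B (k * card ?Q1)"
      using small[OF c(1)] less.prems(2)[OF u] c(2) by simp
    moreover have "rewritable T (Q - ?Q1) B (k * card (Q - ?Q1))"
    proof (rule less.hyps)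
      have "avars ?Q1 \<noteq> {}" using c(2) component_refl[of u "gaifman q" "avars Q - B"] by blast
      then have "?Q1 \<noteq> {}" by (auto simp: avars_def)
      then have "Q - ?Q1 \<subset> Q" by blast
      then show "card (Q - ?Q1) < card Q" using finQ by (intro psubset_card_mono)
      show "subquery q (Q - ?Q1) B" by (fact c(3))
      fix w assume w: "w \<in> avars (Q - ?Q1) - B"
      have "component (gaifman q) (avars (Q - ?Q1) - B) w \<subseteq> component (gaifman q) (avars Q - B) w"
        unfolding c(4) by (intro component_mono) blast
      moreover have "finite (component (gaifman q) (avars Q - B) w)"
      proof (rule finite_subset[OF component_subset])
        show "w \<in> avars Q - B" using w by (auto simp: avars_def)
        show "finite (avars Q - B)" using finQ by (simp add: avars_def)
      qed
      ultimately have "card (component (gaifman q) (avars (Q - ?Q1) - B) w) \<le>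
          card (component (gaifman q) (avars Q - B) w)" by (intro card_mono)
      also have "\<dots> < m" using w by (intro less.prems(2)) (auto simp: avars_def)
      finally show "card (component (gaifman q) (avars (Q - ?Q1) - B) w) < m" .
    qed
    ultimately have "rewritable T (?Q1 \<union> (Q - ?Q1)) B (k * card ?Q1 + k * card (Q - ?Q1))"
      using c(5) by (rule rewritable_Un)
    moreover have "?Q1 \<union> (Q - ?Q1) = Q" by blast
    moreover have "card ?Q1 + card (Q - ?Q1) = card Q"
      using finQ card_Un_disjoint[of ?Q1 "Q - ?Q1"] \<open>?Q1 \<union> (Q - ?Q1) = Q\<close> by auto
    then have "k * card ?Q1 + k * card (Q - ?Q1) = k * card Q"
      by (simp only: distrib_left[symmetric])
    ultimately show ?thesis by simp
  qed
qed

section \<open>The recurrence for the size\<close>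

locale tree_omq = omq +
  assumes tree: "tree_shaped q"
begin

text \<open>The maximum covers the empty ontology, where |T| = 0 while every formula has at least
  one atom.\<close>

abbreviation "K \<equiv> max 1 (ontology_size T)"
abbreviation "d \<equiv> tw_degree T q"

lemma d_pos: "1 \<le> d"
  by (simp add: tw_degree_def)

lemma finite_subquery: "subquery q Q B \<Longrightarrow> finite Q \<and> finite (avars Q)"
  using finite_atoms finite_subset by (fastforce simp: subquery_def avars_def)

lemma tws_tw_hom:
  assumes "t \<in> tws U z"
  obtains \<rho> h where "tw_hom T q \<rho> h t"
  using assms by (auto simp: tws_def tree_witness_by_def)

lemma tws_atoms:
  assumes "subquery q Q B" and "t \<in> tws (avars Q - B) z"
  shows "tw_atoms q t \<subseteq> Q" "tw_atoms q t \<noteq> {}"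
    "card (tw_atoms q t) + card (Q - tw_atoms q t) = card Q" "1 \<le> card (tw_atoms q t)"
proof -
  obtain \<rho> h where h: "tw_hom T q \<rho> h t" using assms(2) by (rule tws_tw_hom)
  have "snd t \<subseteq> avars Q - B" using assms(2) by (simp add: tws_def)
  then show 1: "tw_atoms q t \<subseteq> Q"
    using tw_atoms_iff[OF h] assms(1) unfolding subquery_def by blast
  show 2: "tw_atoms q t \<noteq> {}" using tw_atoms_nonempty[OF h] .
  have "finite Q" using finite_subquery[OF assms(1)] by simp
  then have "finite (tw_atoms q t)" using 1 finite_subset by blast
  then show "1 \<le> card (tw_atoms q t)" using 2 by (simp add: Suc_le_eq card_gt_0_iff)
  show "card (tw_atoms q t) + card (Q - tw_atoms q t) = card Q"
    using 1 \<open>finite Q\<close> \<open>finite (tw_atoms q t)\<close> by (simp add: card_Diff_subset card_mono)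
qed

lemma subquery_ex_vars: "subquery q Q B \<Longrightarrow> avars Q - B \<subseteq> ex_vars q"
  by (auto simp: subquery_def avars_def ex_vars_def cq_vars_def)

text \<open>A tree-witness disjunct spends \<open>card (tw_atoms q t) - 1\<close> equalities and the
  generator atoms. Together this is at most \<open>k\<close> per covered atom, as much as the
  recursion grants these atoms. So each of the at most \<open>d - 1\<close> disjuncts stays within
  \<open>k * card Q\<close>.\<close>

lemma rewritable_step:
  assumes sub: "subquery q Q B" and z: "z \<in> avars Q - B" and k: "K \<le> k"
    and cst: "rewritable T Q (insert z B) s0"
    and null: "\<And>t. t \<in> tws (avars Q - B) z \<Longrightarrow>
      rewritable T (Q - tw_atoms q t) (B \<union> fst t) (k * card (Q - tw_atoms q t))"
  shows "rewritable T Q B (s0 + (d - 1) * (k * card Q))"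
proof (rule rewritable_mono[OF rewritable_split[OF sub z cst null]])
  have "card (tw_atoms q t) - 1 + card (body_gen ` T) + k * card (Q - tw_atoms q t) \<le> k * card Q"
    if t: "t \<in> tws (avars Q - B) z" for t
  proof -
    note a = tws_atoms[OF sub t]
    obtain a' where a': "card (tw_atoms q t) = Suc a'" using a(4) by (cases "card (tw_atoms q t)") auto
    have "card (body_gen ` T) \<le> k" using card_body_gens[OF ont] k by simp
    moreover have "a' \<le> k * a'" using k by simp
    ultimately have "card (tw_atoms q t) - 1 + card (body_gen ` T) \<le> k * card (tw_atoms q t)"
      unfolding a' mult_Suc_right diff_Suc_1 by linarith
    then show ?thesis unfolding a(3)[symmetric] by (simp add: distrib_left)
  qed
  then have "(\<Sum>t\<in>tws (avars Q - B) z. card (tw_atoms q t) - 1 + card (body_gen ` T) +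
      k * card (Q - tw_atoms q t)) \<le> card (tws (avars Q - B) z) * (k * card Q)"
    using sum_bounded_above by (metis (no_types, lifting) of_nat_id)
  also have "\<dots> \<le> (d - 1) * (k * card Q)"
    using card_tws[of z "avars Q - B"] z subquery_ex_vars[OF sub] by (intro mult_right_mono) auto
  finally show "s0 + (\<Sum>t\<in>tws (avars Q - B) z. card (tw_atoms q t) - 1 + card (body_gen ` T) +
      k * card (Q - tw_atoms q t)) \<le> s0 + (d - 1) * (k * card Q)" by simp
qed

text \<open>With one open variable there is at most one tree witness, whatever the degree is. The
  formula has at most two disjuncts, and no factor d is lost at a leaf.\<close>

lemma rewritable_single_variable:
  assumes sub: "subquery q Q B" and U: "avars Q - B = {z}"
  shows "rewritable T Q B (K * card Q)"
proof -
  have z: "z \<in> avars Q - B" using U by simp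
  have finQ: "finite Q" using finite_subquery[OF sub] by simp
  have cst: "rewritable T Q (insert z B) (card Q)"
    using finQ U by (intro rewritable_ground) auto
  have null: "rewritable T (Q - tw_atoms q t) (B \<union> fst t) (card (Q - tw_atoms q t))"
    if t: "t \<in> tws (avars Q - B) z" for t
  proof (rule rewritable_ground)
    obtain \<rho> h where h: "tw_hom T q \<rho> h t" using t by (rule tws_tw_hom)
    show "avars (Q - tw_atoms q t) \<subseteq> B \<union> fst t"
      using subquery_tw(2)[OF sub h] t U by (auto simp: tws_def)
  qed (use finQ in simp)
  \<comment> \<open>The interior can only be \<open>{z}\<close>; it determines the covered atoms,
    and these determine the roots.\<close>
  have unique: "t = t'" if t: "t \<in> tws (avars Q - B) z" and t': "t' \<in> tws (avars Q - B) z" for t t'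
  proof -
    obtain \<rho> h where h: "tw_hom T q \<rho> h t" using t by (rule tws_tw_hom)
    obtain \<rho>' h' where h': "tw_hom T q \<rho>' h' t'" using t' by (rule tws_tw_hom)
    have snd: "snd t = {z}" "snd t' = {z}" using t t' U by (auto simp: tws_def)
    then have tw: "tw_atoms q t = tw_atoms q t'"
      using tw_atoms_iff[OF h] tw_atoms_iff[OF h'] by blast
    have "fst t = avars (tw_atoms q t) - {z}" "fst t' = avars (tw_atoms q t') - {z}"
      using tw_hom_facts(1,2)[OF h] tw_hom_facts(1,2)[OF h'] snd tw_atoms_terms
      unfolding avars_def by blast+
    then show ?thesis using snd tw by (simp add: prod_eq_iff)
  qed
  note split = rewritable_split[OF sub z cst null]
  show ?thesis
  proof (cases "tws (avars Q - B) z = {}")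
    case True
    then show ?thesis using split by (auto elim: rewritable_mono)
  next
    case False
    then obtain t where t: "t \<in> tws (avars Q - B) z" by blast
    then have tws: "tws (avars Q - B) z = {t}" using unique by blast
    have a: "card (tw_atoms q t) + card (Q - tw_atoms q t) = card Q" "1 \<le> card (tw_atoms q t)"
      using tws_atoms[OF sub t] by auto
    have "body_gen ` T \<noteq> {}" using t by (auto simp: tws_def)
    then have g: "1 \<le> card (body_gen ` T)"
      using ont by (simp add: Suc_le_eq card_gt_0_iff ontology_def)
    define b where "b = card (body_gen ` T)"
    have K: "2 * b \<le> K" "1 \<le> b" using card_body_gens[OF ont] g by (auto simp: b_def)
    obtain n where n: "card Q = Suc n" using a by (cases "card Q") auto
    \<comment> \<open>For m = \<open>card Q\<close> the two disjuncts take m + (m - 1 + b) atoms, at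
      most 2bm because (2m - 1)(b - 1) >= 0.\<close>
    have "2 * b * card Q \<le> K * card Q" using K(1) by (rule mult_right_mono) simp
    moreover have "n \<le> b * n" using K(2) by simp
    then have "card Q + (card Q - 1 + b) \<le> 2 * b + 2 * (b * n)" using K(2) n by linarith
    then have "card Q + (card Q - 1 + b) \<le> 2 * b * card Q" by (simp add: n)
    ultimately have "card Q + (card Q - 1 + b) \<le> K * card Q" by (rule order_trans[rotated])
    then have "card Q + (card (tw_atoms q t) - 1 + b + card (Q - tw_atoms q t)) \<le> K * card Q"
      using a by simp
    then show ?thesis using split unfolding tws b_def by (auto elim: rewritable_mono)
  qed
qed

text \<open>The strict bound survives halving: from fewer than 2^(D+2) open variables, the separator
  leaves components of fewer than 2^(D+1). The recursion stops at one variable instead of none,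
  which saves the last level.\<close>

lemma rewritable_pow2:
  assumes "subquery q Q B" and "card (avars Q - B) < 2 ^ Suc D"
  shows "rewritable T Q B (K * d ^ D * card Q)"
  using assms
proof (induction D arbitrary: Q B)
  case 0
  have fin: "finite Q" "finite (avars Q)" using finite_subquery[OF 0(1)] by auto
  show ?case
  proof (cases "avars Q - B = {}")
    case True
    then have "rewritable T Q B (card Q)" using fin by (intro rewritable_ground) auto
    then show ?thesis by (rule rewritable_mono) simp
  next
    case False
    then have "card (avars Q - B) \<noteq> 0" using fin by simp
    then have "card (avars Q - B) = 1" using 0(2) by simp
    then obtain z where "avars Q - B = {z}" by (auto simp: card_1_singleton_iff)
    then show ?thesis using rewritable_single_variable[OF 0(1)] by simp
  qed
next
  case (Suc D)
  have fin: "finite Q" "finite (avars Q)" using finite_subquery[OF Suc.prems(1)] by auto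
  let ?k = "K * d ^ D"
  have "K * 1 \<le> ?k" by (intro mult_le_mono2 one_le_power d_pos)
  then have K: "K \<le> ?k" by (simp only: mult_1_right)
  show ?case
  proof (cases "avars Q - B = {}")
    case True
    then have "rewritable T Q B (card Q)" using fin by (intro rewritable_ground) auto
    then show ?thesis by (rule rewritable_mono) (use d_pos in simp)
  next
    case False
    obtain z where z: "z \<in> avars Q - B" and sep: "\<forall>u\<in>avars Q - B - {z}.
        2 * card (component (gaifman q) (avars Q - B - {z}) u) \<le> card (avars Q - B)"
      by (rule forest_separator[OF acyclic_gaifman[OF tree] sym_gaifman _ False]) (use fin in auto)
    \<comment> \<open>One statement for both kinds of disjunct: whether \<open>z\<close> is fixed or
      lies in the interior of a witness, the remaining open variables are among those left after
      removing the separator.\<close>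
    have small: "rewritable T Q' B' (?k * card Q')"
      if Q': "subquery q Q' B'" "avars Q' - B' \<subseteq> avars Q - B - {z}" for Q' B'
    proof (rule rewritable_components[OF finite_atoms Suc.IH _ Q'(1)])
      fix u assume u: "u \<in> avars Q' - B'"
      let ?C = "component (gaifman q) (avars Q - B - {z}) u"
      have "component (gaifman q) (avars Q' - B') u \<subseteq> ?C" using Q'(2) by (rule component_mono)
      moreover have "?C \<subseteq> avars Q - B - {z}" using u Q'(2) by (intro component_subset) blast
      then have "finite ?C" using fin finite_subset by blast
      ultimately have "card (component (gaifman q) (avars Q' - B') u) \<le> card ?C" by (intro card_mono)
      also have "2 * card ?C < 2 ^ Suc (Suc D)" using bspec[OF sep, of u] u Q'(2) Suc.prems(2) by force
      then have "card ?C < 2 ^ Suc D" by simp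
      finally show "card (component (gaifman q) (avars Q' - B') u) < 2 ^ Suc D" .
    qed auto
    have "rewritable T Q B (?k * card Q + (d - 1) * (?k * card Q))"
    proof (rule rewritable_step[OF Suc.prems(1) z K])
      show "rewritable T Q (insert z B) (?k * card Q)"
        by (rule small) (use Suc.prems(1) subquery_extend in blast)+
      fix t assume t: "t \<in> tws (avars Q - B) z"
      obtain \<rho> h where h: "tw_hom T q \<rho> h t" using t by (rule tws_tw_hom)
      show "rewritable T (Q - tw_atoms q t) (B \<union> fst t) (?k * card (Q - tw_atoms q t))"
        using subquery_tw[OF Suc.prems(1) h] t by (intro small) (auto simp: tws_def)
    qed
    moreover have "?k * card Q + (d - 1) * (?k * card Q) = d * (?k * card Q)"
      using d_pos by (cases d) auto
    ultimately show ?thesis by (simp add: mult_ac)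
  qed
qed

end

subsection \<open>The size bound\<close>

context tree_omq
begin

lemma reach: "u \<in> cq_vars q \<Longrightarrow> v \<in> cq_vars q \<Longrightarrow> (u, v) \<in> (gaifman q)\<^sup>*"
  using tree unfolding tree_shaped_def is_tree_def by blast

lemma card_cq_vars: "card (cq_vars q) \<le> Suc (card (atoms q))"
proof -
  obtain z where z: "z \<in> cq_vars q" using tree unfolding tree_shaped_def is_tree_def by blast
  obtain f where f: "inj_on f (cq_vars q - {z})"
    "\<forall>v\<in>cq_vars q - {z}. f v \<in> atoms q \<and> v \<in> terms (f v)"
    by (rule parent_atoms[OF gaifman_def reach[OF z]])
  have "card (cq_vars q - {z}) \<le> card (atoms q)"
    using f finite_atoms by (intro card_inj_on_le[of f]) auto
  then show ?thesis using z finite_cq_vars by (simp add: card_Diff_singleton)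
qed

text \<open>The tree is connected, so a path from \<open>u\<close> to \<open>z\<close> must leave
  the component, and it can do so only into \<open>z\<close>.\<close>

lemma neighbour_in_component:
  assumes z: "z \<in> cq_vars q" and u: "u \<in> cq_vars q - {z}"
  shows "\<exists>w\<in>component (gaifman q) (cq_vars q - {z}) u. (z, w) \<in> gaifman q"
proof (rule ccontr)
  let ?C = "component (gaifman q) (cq_vars q - {z}) u"
  assume no: "\<not> ?thesis"
  have CV: "?C \<subseteq> cq_vars q - {z}" using u by (rule component_subset)
  have "v \<in> ?C" if "(u, v) \<in> (gaifman q)\<^sup>*" for v
    using that
  proof induction
    case (step x y)
    have "(y, x) \<in> gaifman q" by (rule symD[OF sym_gaifman step.hyps(2)])
    then have "y \<noteq> z" using no step.IH by metis
    moreover have "y \<in> cq_vars q" using subsetD[OF gaifman_subset step.hyps(2)] by simp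
    ultimately show ?case
      using component_closed[OF step.IH step.hyps(2)] subsetD[OF CV step.IH] by simp
  qed simp
  moreover have "(u, z) \<in> (gaifman q)\<^sup>*" using u z by (intro reach) auto
  ultimately have "z \<in> ?C" by blast
  then show False using CV by blast
qed

lemma avars_atoms: "avars (atoms q) = cq_vars q"
  by (simp add: avars_def cq_vars_def)

lemma subquery_whole: "subquery q (atoms q) (set (ans q))"
  by (simp add: subquery_def)

text \<open>For one atom the bound is \<open>K\<close>, with no factor d to spend. A tree witness
  now covers the whole query, so its roots and interior need not be recorded: all witnesses of a
  generator share one disjunct, saying that the generator holds somewhere.\<close>

lemma rewritable_single_atom:
  assumes \<alpha>: "atoms q = {\<alpha>}" and ans: "set (ans q) = {}"
  shows "rewritable T (atoms q) {} K"
proof -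
  have finT: "finite (body_gen ` T)" using ont by (simp add: ontology_def)
  define G where "G = {\<rho> \<in> body_gen ` T. \<exists>t. tree_witness_by T q \<rho> t}"
  have finG: "finite G" using finT by (simp add: G_def)
  obtain xs where xs: "set xs = terms \<alpha>" using finite_list[OF finite_terms[of \<alpha>]] by blast
  let ?atom = "\<lambda>\<rho>. Ex 0 (Atom (map_atom (\<lambda>_. 0) (gen_atom \<rho>)))"
  obtain p where p: "\<And>D (F :: const atom set) \<sigma>. pe_sat D F \<sigma> p \<longleftrightarrow>
      (\<exists>\<rho>\<in>G. pe_sat D F \<sigma> (?atom \<rho>)) \<or> pe_sat D F \<sigma> (foldr Ex xs (Atom \<alpha>))"
    "pe_fv p = (\<Union>\<rho>\<in>G. pe_fv (?atom \<rho>)) \<union> pe_fv (foldr Ex xs (Atom \<alpha>))"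
    "pe_size p = (\<Sum>\<rho>\<in>G. pe_size (?atom \<rho>)) + pe_size (foldr Ex xs (Atom \<alpha>))"
    using disj_set[OF finG, of ?atom "foldr Ex xs (Atom \<alpha>)"] by blast
  have sub: "subquery q {\<alpha>} {}" using subquery_whole \<alpha> ans by simp
  have "rewritten_by T {\<alpha>} {} p"
    unfolding rewritten_by_def
  proof (intro conjI allI impI)
    show "pe_fv p \<subseteq> {}" by (auto simp: p(2) ex_list_fv_size xs atom.set_map)
    fix A \<sigma> assume A: "complete_data T A"
    show "pe_sat (ind A) A \<sigma> p \<longleftrightarrow> hom_ext T A \<sigma> {\<alpha>} {}"
    proof
      assume "pe_sat (ind A) A \<sigma> p"
      then have "(\<exists>\<rho>\<in>G. \<exists>c. map_atom (\<lambda>_. c) (gen_atom \<rho>) \<in> A) \<or> (\<exists>\<sigma>'. map_atom \<sigma>' \<alpha> \<in> A)"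
        unfolding p(1) ex_list by (auto simp: atom.map_comp comp_def)
      then consider \<rho> c where "\<rho> \<in> G" "map_atom (\<lambda>_. c) (gen_atom \<rho>) \<in> A"
        | \<sigma>' where "map_atom \<sigma>' \<alpha> \<in> A" by blast
      then show "hom_ext T A \<sigma> {\<alpha>} {}"
      proof cases
        case 1
        then obtain t h where "\<rho> \<in> body_gen ` T" and h: "tw_hom T q \<rho> h t"
          by (auto simp: G_def tree_witness_by_def)
        moreover have "\<alpha> \<in> tw_atoms q t"
          using tw_atoms_nonempty[OF h] tw_atoms_subset[of q t] \<alpha> by auto
        ultimately have "map_atom (rename (\<lambda>_. c) \<circ> h) \<alpha> \<in> canonical T A"
          using tw_hom_into_canonical 1(2) by blast
        then show ?thesis by (auto simp: hom_ext_def)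
      next
        case 2
        then have "map_atom (Cst \<circ> \<sigma>') \<alpha> \<in> canonical T A"
          using canonical.data[OF 2] by (simp add: atom.map_comp)
        then show ?thesis by (auto simp: hom_ext_def)
      qed
    next
      assume "hom_ext T A \<sigma> {\<alpha>} {}"
      then obtain h where h: "map_atom h \<alpha> \<in> canonical T A" by (auto simp: hom_ext_def)
      show "pe_sat (ind A) A \<sigma> p"
      proof (cases "\<exists>z\<in>terms \<alpha>. h z \<notin> range Cst")
        case True
        then obtain z where z: "z \<in> terms \<alpha>" "h z \<notin> range Cst" by blast
        have hQ: "map_atom h \<alpha>' \<in> canonical T A" if "\<alpha>' \<in> {\<alpha>}" for \<alpha>' using that h by simp
        have zQ: "z \<in> avars {\<alpha>}" using z(1) by (simp add: avars_def)
        have "\<exists>\<rho> t c. \<rho> \<in> body_gen ` T \<and> tree_witness_by T q \<rho> t \<and>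
            map_atom (\<lambda>_. c) (gen_atom \<rho>) \<in> A"
          by (rule exists_tree_witness[OF sub A hQ _ zQ z(2)]; (blast | simp))
        then obtain \<rho> t c where "\<rho> \<in> body_gen ` T" "tree_witness_by T q \<rho> t"
          "map_atom (\<lambda>_. c) (gen_atom \<rho>) \<in> A" by blast
        moreover have "c \<in> terms (map_atom (\<lambda>_. c) (gen_atom \<rho>))"
          by (simp add: atom.set_map image_constant_conv)
        ultimately have "\<rho> \<in> G" "c \<in> ind A" "map_atom (\<lambda>_. c) (gen_atom \<rho>) \<in> A"
          unfolding G_def ind_def by blast+
        then have "\<exists>\<rho>\<in>G. pe_sat (ind A) A \<sigma> (?atom \<rho>)"
          by (intro bexI[of _ \<rho>]) (auto simp: atom.map_comp comp_def)
        then show ?thesis unfolding p(1) by blast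
      next
        case False
        then have "\<forall>v\<in>terms \<alpha>. \<exists>c. h v = Cst c" by blast
        then obtain f where f: "\<forall>v\<in>terms \<alpha>. h v = Cst (f v)" by metis
        define \<sigma>' where "\<sigma>' v = (if v \<in> terms \<alpha> then f v else \<sigma> v)" for v
        have eq: "map_atom h \<alpha> = map_atom Cst (map_atom \<sigma>' \<alpha>)"
          unfolding atom.map_comp using f by (intro atom.map_cong0) (auto simp: \<sigma>'_def)
        then have in_A: "map_atom \<sigma>' \<alpha> \<in> A" using h canonical_ground_iff[OF A] by simp
        then have "terms (map_atom \<sigma>' \<alpha>) \<subseteq> ind A" unfolding ind_def by (rule UN_upper)
        then have "\<sigma>' ` terms \<alpha> \<subseteq> ind A" by (simp add: atom.set_map)
        then have "pe_sat (ind A) A \<sigma> (foldr Ex xs (Atom \<alpha>))"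
          unfolding ex_list xs using in_A by (intro exI[of _ \<sigma>']) (auto simp: \<sigma>'_def)
        then show ?thesis unfolding p(1) by blast
      qed
    qed
  qed
  moreover have "pe_size p \<le> K"
  proof -
    have "card G \<le> card (body_gen ` T)" using finT by (intro card_mono) (auto simp: G_def)
    moreover have "pe_size p = card G + 1" by (simp add: p(3) ex_list_fv_size)
    ultimately show ?thesis using card_body_gens[OF ont] by linarith
  qed
  ultimately show ?thesis unfolding \<alpha> rewritable_def by blast
qed

text \<open>
  If the number of existential variables is a power of two and exceeds the number of atoms,
  halving the variables costs one level too many. But then at most one part of the tree is
  too large, and only if the separator is mapped to a constant.
\<close>

lemma rewritable_critical:
  assumes ans: "set (ans q) = {}" and n: "Suc (card (atoms q)) = 4 * 2 ^ E"
    and m: "card (cq_vars q) = 4 * 2 ^ E"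
  shows "rewritable T (atoms q) {} (K * d ^ E * (card (atoms q) * d + 2 * 2 ^ E * (d - 1)))"
proof -
  let ?Q = "atoms q" and ?V = "cq_vars q" and ?N = "2 * 2 ^ E :: nat" and ?k = "K * d ^ E"
  let ?comp = "\<lambda>W. component (gaifman q) W"
  have sub: "subquery q ?Q {}" using subquery_whole ans by simp
  have "?V \<noteq> {}" using m by auto
  then obtain z where z: "z \<in> ?V" and sep': "\<forall>u\<in>?V - {z}. 2 * card (?comp (?V - {z}) u) \<le> card ?V"
    by (rule forest_separator[OF acyclic_gaifman[OF tree] sym_gaifman finite_cq_vars])
  note sep = bspec[OF sep']
  have compV: "?comp (?V - {z}) u \<subseteq> ?V - {z}" if "u \<in> ?V - {z}" for u
    using that by (rule component_subset)
  have fin: "finite (?comp (?V - {z}) u)" if "u \<in> ?V - {z}" for u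
    using compV[OF that] finite_cq_vars finite_subset by blast
  have "K * 1 \<le> ?k" by (intro mult_le_mono2 one_le_power d_pos)
  then have K: "K \<le> ?k" by (simp only: mult_1_right)
  have small: "rewritable T Q' B' (?k * card Q')"
    if "subquery q Q' B'" "\<And>u. u \<in> avars Q' - B' \<Longrightarrow> card (?comp (avars Q' - B') u) < ?N" for Q' B'
  proof (rule rewritable_components[OF finite_atoms rewritable_pow2 _ that(1)])
    show "card (?comp (avars Q' - B') u) < 2 ^ Suc E" if "u \<in> avars Q' - B'" for u
      using that \<open>\<And>u. u \<in> avars Q' - B' \<Longrightarrow> card (?comp (avars Q' - B') u) < ?N\<close> by simp
  qed auto
  have subz: "subquery q ?Q {z}" using sub by (rule subquery_extend) simp
  \<comment> \<open>\<open>n1\<close> counts the atoms in an oversized component, which pay one more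
    factor d; it is 0 if there is no such component.\<close>
  obtain n1 where n1: "rewritable T ?Q {z} (?k * (n1 * d + (card ?Q - n1)))" "n1 \<le> ?N" "n1 \<le> card ?Q"
  proof (cases "\<exists>u\<in>?V - {z}. ?N \<le> card (?comp (?V - {z}) u)")
    case False
    then have "rewritable T ?Q {z} (?k * card ?Q)"
      using subz by (intro small) (auto simp: avars_atoms not_le)
    then show thesis using that[of 0] by simp
  next
    case True
    then obtain u where u: "u \<in> ?V - {z}" "?N \<le> card (?comp (?V - {z}) u)" by blast
    define C where "C = ?comp (?V - {z}) u"
    define Q1 where "Q1 = {\<alpha> \<in> ?Q. terms \<alpha> \<inter> C \<noteq> {}}"
    have CV: "C \<subseteq> ?V - {z}" and finC: "finite C" using compV[OF u(1)] fin[OF u(1)] by (auto simp: C_def)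
    \<comment> \<open>The separator allows at most half of the variables, so an oversized component
      has exactly half of them, and the rest without \<open>z\<close> has one variable
      fewer.\<close>
    have cardC: "card C = ?N" using u(2) sep[OF u(1)] m by (simp add: C_def)
    have u': "u \<in> avars ?Q - {z}" using u by (simp add: avars_atoms)
    have c: "subquery q Q1 {z}" "avars Q1 - {z} = C" "subquery q (?Q - Q1) {z}"
      "avars (?Q - Q1) - {z} = ?V - {z} - C" "avars Q1 \<inter> avars (?Q - Q1) \<subseteq> {z}"
      using subquery_component[OF subz u'] by (simp_all add: avars_atoms Q1_def C_def)
    have "card (avars Q1 - {z}) < 2 ^ Suc (Suc E)" using c(2) cardC by simp
    then have 1: "rewritable T Q1 {z} (K * d ^ Suc E * card Q1)"
      using rewritable_pow2[OF c(1)] by blast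
    have "card (?V - {z} - C) = card ?V - 1 - card C"
      using CV finC z finite_cq_vars by (simp add: card_Diff_subset card_Diff_singleton)
    then have cardR: "card (?V - {z} - C) = ?N - 1" using m cardC by simp
    have "?N - 1 < 2 ^ Suc E" by simp
    then have "card (avars (?Q - Q1) - {z}) < 2 ^ Suc E" unfolding c(4) cardR .
    then have 2: "rewritable T (?Q - Q1) {z} (?k * card (?Q - Q1))"
      using rewritable_pow2[OF c(3)] by blast
    have Q: "Q1 \<union> (?Q - Q1) = ?Q" by (auto simp: Q1_def)
    have finQ1: "finite Q1" using finite_atoms by (simp add: Q1_def)
    have cardQ: "card (?Q - Q1) = card ?Q - card Q1" "card Q1 \<le> card ?Q"
      using finite_atoms finQ1 by (auto simp: Q1_def card_Diff_subset intro!: card_mono)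
    have "rewritable T ?Q {z} (K * d ^ Suc E * card Q1 + ?k * card (?Q - Q1))"
      using rewritable_Un[OF 1 2 c(5)] unfolding Q .
    also have "K * d ^ Suc E * card Q1 + ?k * card (?Q - Q1) =
        ?k * (card Q1 * d + (card ?Q - card Q1))"
      unfolding cardQ(1) by (simp add: distrib_left mult_ac)
    finally have 3: "rewritable T ?Q {z} (?k * (card Q1 * d + (card ?Q - card Q1)))" .
    \<comment> \<open>Atoms outside \<open>Q1\<close> are counted by the parent atoms of the N - 1
      variables outside \<open>C\<close> and \<open>z\<close>, where N is \<open>2 * 2 ^ E\<close>.
      These atoms cannot touch \<open>C\<close>, so of the 2N - 1 atoms at most N are in
      \<open>Q1\<close>.\<close>
    obtain f where f: "inj_on f (?V - {z})"
      "\<forall>v\<in>?V - {z}. f v \<in> ?Q \<and> v \<in> terms (f v)"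
      "\<forall>v\<in>?V - {z}. \<forall>x\<in>terms (f v). x \<noteq> v \<longrightarrow> (x, v) \<in> gaifman q"
      by (rule parent_atoms[OF gaifman_def reach[OF z]])
    have "f v \<in> ?Q - Q1" if v: "v \<in> ?V - {z} - C" for v
    proof -
      have v': "v \<in> ?V - {z}" "v \<notin> C" using v by auto
      have "terms (f v) \<inter> C = {}"
      proof (rule ccontr)
        assume "terms (f v) \<inter> C \<noteq> {}"
        then obtain x where x: "x \<in> terms (f v)" "x \<in> C" by blast
        then have "(x, v) \<in> gaifman q" using bspec[OF bspec[OF f(3) v'(1)] x(1)] v'(2) by blast
        moreover have "x \<in> ?V - {z}" using x(2) CV by blast
        ultimately have "v \<in> C" using x(2) v'(1) component_closed unfolding C_def by fast
        then show False using v'(2) by blast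
      qed
      then show ?thesis using bspec[OF f(2) v'(1)] by (simp add: Q1_def)
    qed
    moreover have "inj_on f (?V - {z} - C)" using f(1) by (rule inj_on_subset) blast
    ultimately have "card (?V - {z} - C) \<le> card (?Q - Q1)"
      using finite_atoms by (intro card_inj_on_le[of f]) auto
    then have "card Q1 \<le> ?N" using cardR cardQ n by simp
    then show thesis using that[OF 3] cardQ(2) by blast
  qed
  have "rewritable T ?Q {} (?k * (n1 * d + (card ?Q - n1)) + (d - 1) * (?k * card ?Q))"
  proof (rule rewritable_step[OF sub _ K])
    show "z \<in> avars ?Q - {}" using z by (simp add: avars_atoms)
    show "rewritable T ?Q (insert z {}) (?k * (n1 * d + (card ?Q - n1)))" using n1(1) by simp
    fix t assume t: "t \<in> tws (avars ?Q - {}) z"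
    obtain \<rho> h where h: "tw_hom T q \<rho> h t" using t by (rule tws_tw_hom)
    have zt: "z \<in> snd t" using t by (simp add: tws_def)
    let ?U = "avars (?Q - tw_atoms q t) - ({} \<union> fst t)"
    have U: "?U \<subseteq> ?V - fst t - snd t" using subquery_tw(2)[OF sub h] by (auto simp: avars_atoms)
    show "rewritable T (?Q - tw_atoms q t) ({} \<union> fst t) (?k * card (?Q - tw_atoms q t))"
    \<comment> \<open>In a witness disjunct each component loses its neighbour of \<open>z\<close>,
      which becomes a root or interior variable. This one variable is enough to get strictly below
      half.\<close>
    proof (rule small[OF subquery_tw(1)[OF sub h]])
      fix u assume u: "u \<in> ?U"
      have uV: "u \<in> ?V - {z}" using u U zt by blast
      obtain w where w: "w \<in> ?comp (?V - {z}) u" "(z, w) \<in> gaifman q"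
        using neighbour_in_component[OF z uV] by blast
      obtain \<alpha> where \<alpha>: "\<alpha> \<in> ?Q" "z \<in> terms \<alpha>" "w \<in> terms \<alpha>" using w(2) by (auto simp: gaifman_def)
      have "\<alpha> \<in> tw_atoms q t" using tw_atoms_iff[OF h] \<alpha> zt by blast
      then have "w \<notin> ?U" using tw_atoms_terms \<alpha>(3) U by blast
      moreover have "?comp ?U u \<subseteq> ?U" using u by (rule component_subset)
      moreover have "?comp ?U u \<subseteq> ?comp (?V - {z}) u"
        using U zt by (intro component_mono) blast
      ultimately have "?comp ?U u \<subset> ?comp (?V - {z}) u" using w(1) by blast
      then have "card (?comp ?U u) < card (?comp (?V - {z}) u)"
        by (rule psubset_card_mono[OF fin[OF uV]])
      then show "card (?comp ?U u) < ?N" using sep[OF uV] m by linarith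
    qed
  qed
  moreover have "?k * (n1 * d + (card ?Q - n1)) + (d - 1) * (?k * card ?Q) \<le>
      ?k * (card ?Q * d + ?N * (d - 1))"
  proof -
    obtain d' where d': "d = Suc d'" using d_pos by (cases d) auto
    have "n1 * d' \<le> ?N * d'" using n1(2) by (rule mult_right_mono) simp
    then have "n1 * d + (card ?Q - n1) + (d - 1) * card ?Q \<le> card ?Q * d + ?N * (d - 1)"
      using n1(3) by (simp add: d' mult.commute)
    from mult_left_mono[OF this, of ?k] show ?thesis by (simp add: distrib_left mult_ac)
  qed
  ultimately show ?thesis by (rule rewritable_mono)
qed

end

section \<open>Numerical estimates\<close>

lemma pow_le_powr_log:
  fixes d :: nat
  assumes "1 \<le> d" and "2 ^ D \<le> x"
  shows "real d ^ D \<le> x powr log 2 (real d)"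
proof -
  have "real d ^ D = (2 powr log 2 (real d)) ^ D" using assms(1) by simp
  also have "\<dots> = (2 powr real D) powr log 2 (real d)"
    by (simp add: powr_powr powr_realpow[symmetric] mult.commute)
  also have "\<dots> = (2 ^ D) powr log 2 (real d)" by (simp add: powr_realpow)
  also have "\<dots> \<le> x powr log 2 (real d)" using assms by (intro powr_mono2) auto
  finally show ?thesis .
qed

text \<open>After division by \<open>d\<close> and \<open>N = 2 * 2 ^ E\<close> this is \<open>x + 1 - 1 / d \<le> x powr (1 + log 2 d)\<close> for
  \<open>x = n / N\<close>, where \<open>3 / 2 \<le> x\<close>. It is an equality for \<open>d = 1\<close>.\<close>

lemma critical_bound:
  fixes d E :: nat
  assumes d: "1 \<le> d" and n: "Suc n = 4 * 2 ^ E"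
  shows "real (d ^ E * (n * d + 2 * 2 ^ E * (d - 1))) \<le> real n * real n powr log 2 (real d)"
proof -
  define \<alpha> where "\<alpha> = log 2 (real d)"
  define P :: real where "P = 2 ^ E"
  define x where "x = real n / (2 * P)"
  have P: "1 \<le> P" by (simp add: P_def)
  have "real (Suc n) = real (4 * 2 ^ E)" by (simp only: n)
  then have rn: "real n = 4 * P - 1" by (simp add: P_def)
  have x: "3 / 2 \<le> x" using P by (simp add: x_def rn field_simps)
  have nx: "real n = 2 * P * x" using P by (simp add: x_def)
  have \<alpha>: "0 \<le> \<alpha>" "2 powr \<alpha> = real d" using d by (auto simp: \<alpha>_def)
  have key: "x + 1 - 1 / real d \<le> x * x powr \<alpha>"
  proof -
    \<comment> \<open>Up to d = 4 the exponent 1 is enough: x * x - x is at least 3/4 for x >= 3/2,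
      and 1 - 1/d is at most 3/4. From there on log d >= 2, and the cubic growth makes even the term
      1/d dispensable.\<close>
    consider "d = 1" | "2 \<le> d" "d \<le> 4" | "4 < d" using d by linarith
    then show ?thesis
    proof cases
      case 1
      then show ?thesis using x by (simp add: \<alpha>_def)
    next
      case 2
      then have "1 \<le> \<alpha>" unfolding \<alpha>_def by (simp add: le_log_iff)
      then have "x powr 1 \<le> x powr \<alpha>" using x by (intro powr_mono) auto
      then have "x * x \<le> x * x powr \<alpha>" using x by simp
      moreover have "3 / 4 \<le> x * x - x"
      proof -
        have "(3 / 2) * (1 / 2) \<le> x * (x - 1)" using x by (intro mult_mono) auto
        then show ?thesis by (simp add: algebra_simps)
      qed
      moreover have "1 / 4 \<le> 1 / real d" using 2 by (intro divide_left_mono) auto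
      ultimately show ?thesis by linarith
    next
      case 3
      then have "2 \<le> \<alpha>" unfolding \<alpha>_def by (simp add: le_log_iff)
      then have "x powr 2 \<le> x powr \<alpha>" using x by (intro powr_mono) auto
      then have "x ^ 2 \<le> x powr \<alpha>" using x by (simp add: powr_numeral)
      then have "x * x ^ 2 \<le> x * x powr \<alpha>" using x by simp
      moreover have "x + 1 \<le> x * x ^ 2"
      proof -
        have "(3 / 2) * (3 / 2) \<le> x * x" using x by (intro mult_mono) auto
        then have "x * 2 \<le> x * x ^ 2" using x by (intro mult_left_mono) (auto simp: power2_eq_square)
        then show ?thesis using x by linarith
      qed
      moreover have "0 \<le> 1 / real d" by simp
      ultimately show ?thesis by linarith
    qed
  qed
  have "real n powr \<alpha> = P powr \<alpha> * 2 powr \<alpha> * x powr \<alpha>"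
    unfolding nx using P x by (simp add: powr_mult)
  also have "P powr \<alpha> = real d ^ E"
  proof -
    have "P powr \<alpha> = (2 powr real E) powr \<alpha>" by (simp add: P_def powr_realpow)
    also have "\<dots> = (2 powr \<alpha>) powr real E" by (simp add: powr_powr mult.commute)
    also have "\<dots> = real d ^ E" using d \<alpha>(2) by (simp add: powr_realpow)
    finally show ?thesis .
  qed
  finally have np: "real n powr \<alpha> = real d ^ E * real d * x powr \<alpha>" using \<alpha>(2) by simp
  have "real (d ^ E * (n * d + 2 * 2 ^ E * (d - 1))) =
      real d ^ E * (real n * real d + 2 * P * (real d - 1))"
    using d by (simp add: P_def of_nat_diff)
  also have "\<dots> = (real d ^ E * (2 * P) * real d) * (x + 1 - 1 / real d)"
    unfolding nx using d by (simp add: field_simps)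
  also have "\<dots> \<le> (real d ^ E * (2 * P) * real d) * (x * x powr \<alpha>)"
    using key P by (intro mult_left_mono) auto
  also have "\<dots> = real n * real n powr \<alpha>"
    unfolding np by (simp add: nx)
  finally show ?thesis unfolding \<alpha>_def .
qed

text \<open>With 2^D <= n < 2^(D+1), fewer than 2^(D+1) existential variables need D levels, and d^D
  is at most \<open>n powr log 2 d\<close>. A tree with n atoms can miss this only by having exactly
  2^(D+1) existential variables.\<close>

lemma (in tree_omq) rewritable_whole:
  obtains s where "rewritable T (atoms q) (set (ans q)) s"
    "real s \<le> real K * real (cq_size q) powr (1 + log 2 (real d))"
proof -
  let ?n = "card (atoms q)" and ?\<alpha> = "log 2 (real d)"
  have "atoms q \<noteq> {}" using cq by (simp add: is_cq_def)
  then have n: "1 \<le> ?n" using finite_atoms by (simp add: Suc_le_eq card_gt_0_iff)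
  have goal: "real s \<le> real K * real (cq_size q) powr (1 + ?\<alpha>)"
    if "real s \<le> real K * (real ?n * real ?n powr ?\<alpha>)" for s
    using that n by (simp add: cq_size_def powr_add)
  obtain D where D: "2 ^ D \<le> ?n" "?n < 2 ^ Suc D"
    using ex_power_ivl1[of 2 ?n] n by auto
  have ex: "avars (atoms q) - set (ans q) = ex_vars q" by (simp add: avars_atoms ex_vars_def)
  show thesis
  proof (cases "card (ex_vars q) < 2 ^ Suc D")
    case True
    have "real d ^ D \<le> real ?n powr ?\<alpha>"
    proof (rule pow_le_powr_log[OF d_pos])
      have "real (2 ^ D) \<le> real ?n" using D(1) by (simp only: of_nat_le_iff)
      then show "2 ^ D \<le> real ?n" by simp
    qed
    then have "real K * (real ?n * real d ^ D) \<le> real K * (real ?n * real ?n powr ?\<alpha>)"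
      by (intro mult_left_mono) auto
    then have size: "real (K * d ^ D * ?n) \<le> real K * (real ?n * real ?n powr ?\<alpha>)"
      by (simp add: mult_ac)
    have "card (avars (atoms q) - set (ans q)) < 2 ^ Suc D" unfolding ex by (fact True)
    from that[OF rewritable_pow2[OF subquery_whole this] goal[OF size]] show thesis .
  next
    \<comment> \<open>Now all of 2^(D+1) <= \<open>card (ex_vars q)\<close> <=
      \<open>card (cq_vars q)\<close> <= n + 1 <= 2^(D+1) are equalities, so every variable is
      existential and the query is Boolean.\<close>
    case False
    have "ex_vars q \<subseteq> cq_vars q" by (auto simp: ex_vars_def)
    then have "card (ex_vars q) \<le> card (cq_vars q)" using finite_cq_vars by (rule card_mono[rotated])
    then have m: "card (ex_vars q) = card (cq_vars q)" "card (cq_vars q) = 2 ^ Suc D"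
      "Suc ?n = 2 ^ Suc D"
      using card_cq_vars D False by linarith+
    then have "ex_vars q = cq_vars q"
      using \<open>ex_vars q \<subseteq> cq_vars q\<close> finite_cq_vars by (intro card_subset_eq)
    then have "set (ans q) \<inter> cq_vars q = {}" unfolding ex_vars_def by (metis Diff_disjoint)
    moreover have "set (ans q) \<subseteq> cq_vars q" using cq by (simp add: is_cq_def)
    ultimately have ans: "set (ans q) = {}" by (simp only: Int_absorb2)
    show thesis
    proof (cases D)
      case 0
      then have "?n = 1" using m(3) by simp
      then obtain \<alpha> where "atoms q = {\<alpha>}" by (auto simp: card_1_singleton_iff)
      then have "rewritable T (atoms q) {} K" using ans by (rule rewritable_single_atom)
      then show thesis using that[of K] ans goal[of K] \<open>?n = 1\<close> by simp
    next
      case (Suc E)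
      let ?s = "d ^ E * (?n * d + 2 * 2 ^ E * (d - 1))"
      have "Suc ?n = 4 * 2 ^ E" "card (cq_vars q) = 4 * 2 ^ E" using m Suc by simp_all
      then have "rewritable T (atoms q) {} (K * ?s)" and s: "real ?s \<le> real ?n * real ?n powr ?\<alpha>"
        using rewritable_critical[OF ans] critical_bound[OF d_pos] by (simp_all add: mult.assoc)
      moreover have "real (K * ?s) \<le> real K * (real ?n * real ?n powr ?\<alpha>)"
        unfolding of_nat_mult[of K] using s by (rule mult_left_mono) simp
      ultimately show thesis using that[of "K * ?s"] ans goal[of "K * ?s"] by simp
    qed
  qed
qed

lemma rewritten_by_pe_rewriting:
  assumes "rewritten_by T (atoms q) (set (ans q)) p"
  shows "pe_rewriting T q p"
  unfolding pe_rewriting_def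
proof (intro conjI allI impI)
  show "pe_fv p \<subseteq> set (ans q)" using assms by (simp add: rewritten_by_def)
  fix A as
  assume "finite A \<and> complete_data T A \<and> length as = length (ans q) \<and> set as \<subseteq> ind A"
  then have A: "complete_data T A" by blast
  have "(\<exists>h. map h (ans q) = map Cst as \<and> (\<forall>\<alpha>\<in>atoms q. map_atom h \<alpha> \<in> canonical T A)) \<longleftrightarrow>
      (\<exists>\<sigma>. map \<sigma> (ans q) = as \<and> hom_ext T A \<sigma> (atoms q) (set (ans q)))"
  proof
    assume "\<exists>h. map h (ans q) = map Cst as \<and> (\<forall>\<alpha>\<in>atoms q. map_atom h \<alpha> \<in> canonical T A)"
    then obtain h where h: "map h (ans q) = map Cst as"
      "\<forall>\<alpha>\<in>atoms q. map_atom h \<alpha> \<in> canonical T A" by blast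
    define \<sigma> where "\<sigma> = inv Cst \<circ> h"
    have inv: "inv Cst (Cst c) = c" for c by (simp add: inj_def)
    have "map \<sigma> (ans q) = map (inv Cst) (map Cst as)" unfolding \<sigma>_def h(1)[symmetric] by simp
    then have "map \<sigma> (ans q) = as" by (simp add: o_def inv)
    moreover have "h v = Cst (\<sigma> v)" if "v \<in> set (ans q)" for v
    proof -
      have "h v \<in> set (map Cst as)" using that unfolding h(1)[symmetric] by simp
      then show ?thesis by (auto simp: \<sigma>_def inv)
    qed
    ultimately show "\<exists>\<sigma>. map \<sigma> (ans q) = as \<and> hom_ext T A \<sigma> (atoms q) (set (ans q))"
      unfolding hom_ext_def using h(2) by blast
  next
    assume "\<exists>\<sigma>. map \<sigma> (ans q) = as \<and> hom_ext T A \<sigma> (atoms q) (set (ans q))"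
    then show "\<exists>h. map h (ans q) = map Cst as \<and> (\<forall>\<alpha>\<in>atoms q. map_atom h \<alpha> \<in> canonical T A)"
      unfolding hom_ext_def by fastforce
  qed
  then show "entails_cq T A q as \<longleftrightarrow> data_sat A p (ans q) as"
    unfolding entails_cq_iff_canonical data_sat_def
    using assms A by (simp add: rewritten_by_def)
qed

theorem theorem22:
  fixes q :: cq and T :: "tgd set"
  assumes "is_cq q" and "tree_shaped q" and "ontology T"
  shows "\<exists>p. pe_rewriting T q p \<and>
           real (pe_size p) \<le>
             real (max 1 (ontology_size T)) * real (cq_size q) powr (1 + log 2 (real (tw_degree T q)))"
proof -
  interpret tree_omq T q using assms by unfold_locales
  obtain s where s: "rewritable T (atoms q) (set (ans q)) s"
    "real s \<le> real K * real (cq_size q) powr (1 + log 2 (real d))"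
    by (rule rewritable_whole)
  have "atoms q \<noteq> {}" using assms(1) by (simp add: is_cq_def)
  then obtain p where "rewritten_by T (atoms q) (set (ans q)) p" "pe_size p \<le> s"
    using s(1) by (auto simp: rewritable_def)
  then show ?thesis using rewritten_by_pe_rewriting s(2) by (meson of_nat_mono order_trans)
qed

end
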